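(* Consider the \textsc{Top}-$k$ problem in the noisy comparison model, with $k\le n/2$. Fix a set $X$ of $n$ elements, an integer $r$, and $\delta\in[1/n^7,1]$, and let $b$ be defined by $r=\log_b^*(n)+4$. There is an algorithm ($\mathbf{Top}$) that computes the \textsc{Top}-$k$ elements of $X$ with correctness probability at least $1-\delta$, with round complexity $r$ and query complexity $q=O(n\log(kb/\delta))$.
   Context: \textsc{Top}-$k$ problem: given $n$ elements carrying values (possibly with ties), output a set of $k$ elements such that no element outside the set has a value strictly larger than the value of an element in the set. Noisy comparison model: queries are of the form ``is the value of $x$ at least the value of $y$?'', answered correctly with probability $2/3$ and arbitrarily (adversarially) otherwise. Round complexity $r$: the queries can be partitioned into $r$ batches each depending only on answers to previous batches. For $b>1$, $\log_b^*(n)$ is the least $i$ with $a_i\le 0$ for $a_0=n$, $a_{j+1}=\log_b a_j$. *)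

theory Defs
  imports "HOL-Probability.Probability" "HOL-Library.Extended_Nat"
begin

text \<open>
  \<open>(x, y)\<close> stands for the query "is the value of x at least the value of y?".
\<close>

type_synonym 'a query = "'a \<times> 'a"

definition truth :: "('a \<Rightarrow> real) \<Rightarrow> 'a query \<Rightarrow> bool" where
  "truth v q \<longleftrightarrow> v (fst q) \<ge> v (snd q)"

definition is_top_k :: "('a \<Rightarrow> real) \<Rightarrow> 'a set \<Rightarrow> nat \<Rightarrow> 'a set \<Rightarrow> bool" where
  "is_top_k v X k S \<longleftrightarrow>
     S \<subseteq> X \<and> card S = k \<and> (\<forall>x\<in>S. \<forall>y\<in>X - S. \<not> v y > v x)"

text \<open>
  A randomized algorithm is a decision tree. A node \<open>Batch qs f\<close> is one round: all queries in
  \<open>qs\<close> (repetitions allowed) are asked at once, and \<open>f\<close> maps the list of answers, which has the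
  same length as \<open>qs\<close>, to the rest of the algorithm.
\<close>

datatype 'a algorithm =
    Output "'a set"
  | Random "'a algorithm pmf"
  | Batch "'a query list" "bool list \<Rightarrow> 'a algorithm"

text \<open>
  The suprema range over all coin tosses and all answers, so rounds and queries are
  counted in the worst case.
\<close>

primrec rounds :: "'a algorithm \<Rightarrow> enat" where
  "rounds (Output S) = 0"
| "rounds (Random p) = Sup (set_pmf (map_pmf rounds p))"
| "rounds (Batch qs f) = 1 + (SUP as\<in>{as. length as = length qs}. rounds (f as))"

primrec query_count :: "'a algorithm \<Rightarrow> enat" where
  "query_count (Output S) = 0"
| "query_count (Random p) = Sup (set_pmf (map_pmf query_count p))"
| "query_count (Batch qs f) =
     enat (length qs) + (SUP as\<in>{as. length as = length qs}. query_count (f as))"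

primrec queried :: "'a algorithm \<Rightarrow> 'a query set" where
  "queried (Output S) = {}"
| "queried (Random p) = \<Union> (set_pmf (map_pmf queried p))"
| "queried (Batch qs f) = set qs \<union> (\<Union>as\<in>{as. length as = length qs}. queried (f as))"

text \<open>
  Past rounds, each with its queries, its noise pattern (\<open>True\<close> means that the query has to be
  answered correctly), and the answers that were given.
\<close>

type_synonym 'a history = "('a query list \<times> bool list \<times> bool list) list"

text \<open>
  The adversary sees the history, the current \<open>Batch\<close> node of the algorithm (hence its queries
  and the outcome of all earlier coin tosses) and the noise pattern of the current batch. It
  proposes an answer for each position of the batch; the proposals are used exactly at the
  positions whose noise bit is \<open>False\<close>. It does not see future coin tosses or noise.
\<close>

type_synonym 'a adversary =
  "'a history \<Rightarrow> 'a algorithm \<Rightarrow> bool list \<Rightarrow> nat \<Rightarrow> bool"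

definition noisy_answers ::
    "('a \<Rightarrow> real) \<Rightarrow> 'a query list \<Rightarrow> bool list \<Rightarrow> (nat \<Rightarrow> bool) \<Rightarrow> bool list" where
  "noisy_answers v qs ok lie =
     map (\<lambda>i. if ok ! i then truth v (qs ! i) else lie i) [0..<length qs]"

text \<open>The distribution of the output; every query is independently noise-free with probability 2/3.\<close>

primrec run ::
    "('a \<Rightarrow> real) \<Rightarrow> 'a adversary \<Rightarrow> 'a algorithm \<Rightarrow> 'a history \<Rightarrow> 'a set pmf" where
  "run v adv (Output S) = (\<lambda>h. return_pmf S)"
| "run v adv (Random p) = (\<lambda>h. bind_pmf (map_pmf (run v adv) p) (\<lambda>g. g h))"
| "run v adv (Batch qs f) = (\<lambda>h.
     bind_pmf (replicate_pmf (length qs) (bernoulli_pmf (2/3))) (\<lambda>ok.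
       let as = noisy_answers v qs ok (adv h (Batch qs f) ok)
       in run v adv (f as) (h @ [(qs, ok, as)])))"

lemma run_Random: "run v adv (Random p) h = bind_pmf p (\<lambda>A. run v adv A h)"
  by (simp add: bind_map_pmf)

text \<open>
  The value is \<open>\<infinity>\<close> if the iterates never become nonpositive, which happens when \<open>b\<close> is close to 1.
\<close>

definition log_star :: "real \<Rightarrow> real \<Rightarrow> enat" where
  "log_star b x = (INF i\<in>{i. (log b ^^ i) x \<le> 0}. enat i)"

end

theory Submission
  imports Defs "HOL-Probability.Hoeffding" "HOL-Real_Asymp.Real_Asymp"
begin

text \<open>
  Breaking ties by an index makes the order strict, so there is a unique target set. A comparison
  repeated \<open>R\<close> times and decided by majority errs with probability at most \<open>exp (- R / 18)\<close>,
  whatever the adversary does.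

  Given candidates \<open>M\<close> and a random sample of \<open>M\<close>, the number of sample elements above \<open>x\<close>
  estimates the rank of \<open>x\<close> in \<open>M\<close>. Accepting clearly high and rejecting clearly low elements leaves
  \<open>O(|M| sqrt (log n / s))\<close> candidates for sample size \<open>s\<close>. This takes one round if \<open>M\<close> is compared
  with the whole sample, and two rounds but fewer queries if the sample is sorted first and
  \<open>M\<close> is compared with two pivots only. Once \<open>n powr (4/5)\<close> candidates are left, a two-round step,
  a one-round step and one round of all comparisons finish with at most \<open>n\<close> queries.

  If \<open>k\<close> is so large that some elements can be accepted after the first sample, then \<open>k \<ge> sqrt n\<close>, and
  \<open>O(n log n)\<close> queries are allowed: one more two-round step gives six rounds. Otherwise
  a single pivot of the first sample serves for repeated elimination: with \<open>B = max b 16\<close>, the fraction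
  of surviving candidates shrinks like the inverse of a tower of powers of \<open>B\<close>, so that
  one round less than the iterated logarithm suffices, and the query numbers of these rounds decrease
  geometrically.
\<close>


section \<open>Probabilistic preliminaries\<close>

text \<open>Outside the good event \<open>Q\<close> the inner probability is bounded by 1, which
  costs \<open>e1\<close> in total. The error bounds for coin tosses and for batches both come from
  this split.\<close>

lemma prob_bind_pmf_le:
  assumes "measure_pmf.prob p {x. \<not> Q x} \<le> e1"
    and "\<And>x. x \<in> set_pmf p \<Longrightarrow> Q x \<Longrightarrow> measure_pmf.prob (f x) S \<le> e2" and "0 \<le> e2"
  shows "measure_pmf.prob (bind_pmf p f) S \<le> e1 + e2"
proof -
  have e1: "0 \<le> e1"
    using assms(1) measure_nonneg order_trans by blast
  have "emeasure (bind_pmf p f) S = (\<integral>\<^sup>+x. emeasure (f x) S \<partial>p)"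
    by simp
  also have "\<dots> \<le> (\<integral>\<^sup>+x. indicator {x. \<not> Q x} x + ennreal e2 \<partial>p)"
  proof (rule nn_integral_mono_AE, rule AE_pmfI)
    fix x assume x: "x \<in> set_pmf p"
    show "emeasure (f x) S \<le> indicator {x. \<not> Q x} x + ennreal e2"
    proof (cases "Q x")
      case True
      then show ?thesis
        using assms(2)[OF x True] by (simp add: measure_pmf.emeasure_eq_measure ennreal_leI)
    next
      case False
      have "emeasure (f x) S \<le> 1" by (rule measure_pmf.emeasure_le_1)
      also have "1 \<le> 1 + ennreal e2" by simp
      finally show ?thesis using False by simp
    qed
  qed
  also have "\<dots> = emeasure p {x. \<not> Q x} + ennreal e2"
    by (subst nn_integral_add) (auto simp: measure_pmf.emeasure_space_1)
  also have "\<dots> \<le> ennreal e1 + ennreal e2"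
    using assms(1) by (simp add: measure_pmf.emeasure_eq_measure ennreal_leI)
  also have "\<dots> = ennreal (e1 + e2)"
    using e1 assms(3) by simp
  finally show ?thesis
    using e1 assms(3) by (simp add: measure_pmf.emeasure_eq_measure del: ennreal_plus)
qed

lemma prob_union_bound:
  assumes "finite I" "\<And>i. i \<in> I \<Longrightarrow> measure_pmf.prob p {x. P i x} \<le> e"
  shows "measure_pmf.prob p {x. \<exists>i\<in>I. P i x} \<le> real (card I) * e"
proof -
  have "{x. \<exists>i\<in>I. P i x} = (\<Union>i\<in>I. {x. P i x})" by auto
  also have "measure_pmf.prob p \<dots> \<le> (\<Sum>i\<in>I. measure_pmf.prob p {x. P i x})"
    using assms(1) by (intro measure_pmf.finite_measure_subadditive_finite) auto
  also have "\<dots> \<le> (\<Sum>i\<in>I. e)" using assms(2) by (intro sum_mono)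
  finally show ?thesis by simp
qed

lemma map_pmf_bernoulli: "map_pmf P p = bernoulli_pmf (measure_pmf.prob p {x. P x})"
proof (rule pmf_eqI)
  fix b :: bool
  have F: "measure_pmf.prob p {x. \<not> P x} = 1 - measure_pmf.prob p {x. P x}"
    using measure_pmf.prob_compl[of "{x. P x}" p] by (simp add: Compl_eq_Diff_UNIV[symmetric] Collect_neg_eq)
  show "pmf (map_pmf P p) b = pmf (bernoulli_pmf (measure_pmf.prob p {x. P x})) b"
    by (cases b) (auto simp: pmf_map vimage_def F)
qed

lemma map_replicate_pmf: "map_pmf (map f) (replicate_pmf m p) = replicate_pmf m (map_pmf f p)"
proof (induction m)
  case (Suc m)
  have "map_pmf (map f) (replicate_pmf (Suc m) p) =
      bind_pmf p (\<lambda>x. bind_pmf (map_pmf (map f) (replicate_pmf m p)) (\<lambda>xs. return_pmf (f x # xs)))"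
    by (simp add: map_bind_pmf bind_map_pmf)
  then show ?case by (simp add: Suc.IH bind_map_pmf)
qed simp

text \<open>Turns counts in an independent sample into a binomial variable, to which Hoeffding's
  inequality applies.\<close>

lemma filter_count_replicate_pmf:
  "map_pmf (\<lambda>xs. length (filter P xs)) (replicate_pmf m p) =
     binomial_pmf m (measure_pmf.prob p {x. P x})"
proof -
  have "binomial_pmf m (measure_pmf.prob p {x. P x}) =
      map_pmf (length \<circ> filter id) (map_pmf (map P) (replicate_pmf m p))"
    by (subst binomial_pmf_altdef) (auto simp: map_replicate_pmf map_pmf_bernoulli)
  also have "\<dots> = map_pmf (\<lambda>xs. length (filter P xs)) (replicate_pmf m p)"
    by (simp add: map_pmf_comp o_def filter_map)
  finally show ?thesis ..
qed

lemma filter_count_Hoeffding: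
  fixes e :: real and p :: "'b pmf" and P :: "'b \<Rightarrow> bool"
  assumes "m > 0" "e \<ge> 0"
  defines "\<mu> \<equiv> measure_pmf.prob p {x. P x}"
  shows filter_count_ge: "measure_pmf.prob (replicate_pmf m p)
      {xs. real (length (filter P xs)) \<ge> real m * \<mu> + e} \<le> exp (-2 * e\<^sup>2 / m)"
    and filter_count_le: "measure_pmf.prob (replicate_pmf m p)
      {xs. real (length (filter P xs)) \<le> real m * \<mu> - e} \<le> exp (-2 * e\<^sup>2 / m)"
    and filter_count_abs_ge: "measure_pmf.prob (replicate_pmf m p)
      {xs. \<bar>real (length (filter P xs)) - real m * \<mu>\<bar> \<ge> e} \<le> 2 * exp (-2 * e\<^sup>2 / m)"
proof -
  interpret binomial_distribution m \<mu>
    by unfold_locales (auto simp: \<mu>_def)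
  have *: "measure_pmf.prob (replicate_pmf m p) {xs. Q (length (filter P xs))} =
      measure_pmf.prob (binomial_pmf m \<mu>) {c. Q c}" for Q
    by (simp add: \<mu>_def vimage_def flip: filter_count_replicate_pmf)
  show "measure_pmf.prob (replicate_pmf m p)
      {xs. real (length (filter P xs)) \<ge> real m * \<mu> + e} \<le> exp (-2 * e\<^sup>2 / m)"
    by (subst *) (rule prob_ge[OF assms(1,2)])
  show "measure_pmf.prob (replicate_pmf m p)
      {xs. real (length (filter P xs)) \<le> real m * \<mu> - e} \<le> exp (-2 * e\<^sup>2 / m)"
    by (subst *) (rule prob_le[OF assms(1,2)])
  show "measure_pmf.prob (replicate_pmf m p)
      {xs. \<bar>real (length (filter P xs)) - real m * \<mu>\<bar> \<ge> e} \<le> 2 * exp (-2 * e\<^sup>2 / m)"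
    by (subst *) (rule prob_abs_ge[OF assms(1,2)])
qed

section \<open>Noise of a batch as independent blocks\<close>

lemma map_nth_replicate_pmf:
  assumes "i < m"
  shows "map_pmf (\<lambda>xs. xs ! i) (replicate_pmf m p) = p"
  using assms
proof (induction m arbitrary: i)
  case (Suc m)
  show ?case
  proof (cases i)
    case 0
    then show ?thesis by (simp add: map_bind_pmf bind_return_pmf')
  next
    case (Suc j)
    then show ?thesis using Suc.IH[of j] Suc.prems
      by (simp add: map_bind_pmf map_pmf_def[symmetric] map_pmf_comp)
  qed
qed simp

definition blocks :: "nat \<Rightarrow> nat \<Rightarrow> 'b list \<Rightarrow> 'b list list" where
  "blocks R m xs = map (\<lambda>i. take R (drop (i * R) xs)) [0..<m]"

lemma blocks_Suc: "length xs = R \<Longrightarrow> blocks R (Suc m) (xs @ ys) = xs # blocks R m ys"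
  unfolding blocks_def by (simp add: upt_conv_Cons map_Suc_upt[symmetric] del: upt_Suc)

text \<open>Consecutive blocks of independent bits are independent, so each comparison of a batch
  gets its own independent noise.\<close>

lemma map_blocks_replicate_pmf:
  "map_pmf (blocks R m) (replicate_pmf (m * R) p) = replicate_pmf m (replicate_pmf R p)"
proof (induction m)
  case 0
  then show ?case by (simp add: blocks_def)
next
  case (Suc m)
  have "map_pmf (blocks R (Suc m)) (replicate_pmf (Suc m * R) p) =
    bind_pmf (replicate_pmf R p) (\<lambda>xs. bind_pmf (replicate_pmf (m * R) p)
      (\<lambda>ys. return_pmf (blocks R (Suc m) (xs @ ys))))"
    by (simp add: replicate_pmf_distrib map_bind_pmf)
  also have "\<dots> = bind_pmf (replicate_pmf R p) (\<lambda>xs. bind_pmf (replicate_pmf (m * R) p)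
      (\<lambda>ys. return_pmf (xs # blocks R m ys)))"
    by (intro bind_pmf_cong refl) (auto simp: blocks_Suc set_replicate_pmf)
  also have "\<dots> = replicate_pmf (Suc m) (replicate_pmf R p)"
    by (simp add: Suc.IH[symmetric] bind_map_pmf)
  finally show ?case .
qed

text \<open>Refers to the noise alone, so its probability is beyond the influence of the adversary.
  Exactly half correct counts as bad, since the adversary can then prevent a strict
  majority.\<close>

definition bad_block :: "bool list \<Rightarrow> bool" where
  "bad_block ok \<longleftrightarrow> 2 * length (filter id ok) \<le> length ok"

text \<open>Hoeffding with deviation \<open>R / 6\<close>, the gap between the mean
  \<open>2 * R / 3\<close> and \<open>R / 2\<close>; the exponent is
  \<open>2 * (R / 6)^2 / R = R / 18\<close>.\<close>

lemma prob_bad_block: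
  "measure_pmf.prob (replicate_pmf R (bernoulli_pmf (2/3))) {ok. bad_block ok} \<le> exp (- real R / 18)"
proof (cases "R = 0")
  case False
  let ?p = "replicate_pmf R (bernoulli_pmf (2/3))"
  have two_thirds: "measure_pmf.prob (bernoulli_pmf (2/3)) {x. x} = 2/3"
  proof -
    have "{x. x} = {True}" by auto
    then show ?thesis using pmf_bernoulli_True[of "2/3"] by (simp add: pmf.rep_eq)
  qed
  have "measure_pmf.prob ?p {ok. bad_block ok} \<le>
    measure_pmf.prob ?p {ok. real (length (filter (\<lambda>x. x) ok)) \<le>
      real R * measure_pmf.prob (bernoulli_pmf (2/3)) {x. x} - real R / 6}"
    by (rule measure_pmf.finite_measure_mono_AE)
       (auto simp: AE_measure_pmf_iff set_replicate_pmf bad_block_def two_thirds id_def)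
  also have "\<dots> \<le> exp (- 2 * (real R / 6)\<^sup>2 / real R)"
    using False by (intro filter_count_le) auto
  also have "- 2 * (real R / 6)\<^sup>2 / real R = - real R / 18"
    using False by (simp add: power2_eq_square field_simps)
  finally show ?thesis .
qed simp

section \<open>Reliability and cost of decision trees\<close>

text \<open>Quantifying over the history makes the notion compositional: the rest of an algorithm
  starts with whatever the earlier rounds have left.\<close>

definition reliable :: "('a \<Rightarrow> real) \<Rightarrow> 'a set \<Rightarrow> real \<Rightarrow> 'a algorithm \<Rightarrow> bool" where
  "reliable v T \<epsilon> A \<longleftrightarrow> (\<forall>adv h. measure_pmf.prob (run v adv A h) (- {T}) \<le> \<epsilon>)"

lemma reliable_nonneg: "reliable v T \<epsilon> A \<Longrightarrow> 0 \<le> \<epsilon>"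
  unfolding reliable_def by (meson measure_nonneg order_trans)

lemma reliable_mono: "reliable v T \<epsilon> A \<Longrightarrow> \<epsilon> \<le> \<epsilon>' \<Longrightarrow> reliable v T \<epsilon>' A"
  unfolding reliable_def by (meson order_trans)

lemma reliable_Output: "reliable v T 0 (Output T)"
  unfolding reliable_def by simp

lemma reliable_Random:
  assumes "measure_pmf.prob p {x. \<not> Q x} \<le> e"
    and "\<And>x. x \<in> set_pmf p \<Longrightarrow> Q x \<Longrightarrow> reliable v T \<epsilon> (f x)" and "0 \<le> \<epsilon>"
  shows "reliable v T (e + \<epsilon>) (Random (map_pmf f p))"
  unfolding reliable_def
proof (intro allI)
  fix adv h
  have "measure_pmf.prob (bind_pmf p (\<lambda>x. run v adv (f x) h)) (- {T}) \<le> e + \<epsilon>"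
    using assms by (intro prob_bind_pmf_le[where Q = Q]) (auto simp: reliable_def)
  then show "measure_pmf.prob (run v adv (Random (map_pmf f p)) h) (- {T}) \<le> e + \<epsilon>"
    by (simp add: bind_map_pmf)
qed

text \<open>The continuation is assumed reliable for every \<open>lie\<close>, so it does not matter
  how the adversary's proposals depend on history, coin tosses and noise.\<close>

lemma reliable_Batch:
  assumes "measure_pmf.prob (replicate_pmf (length qs) (bernoulli_pmf (2/3))) {ok. \<not> Q ok} \<le> e"
    and "\<And>ok lie. length ok = length qs \<Longrightarrow> Q ok \<Longrightarrow> reliable v T \<epsilon> (f (noisy_answers v qs ok lie))"
    and "0 \<le> \<epsilon>"
  shows "reliable v T (e + \<epsilon>) (Batch qs f)"
  unfolding reliable_def run.simps Let_def
  using assms by (intro allI prob_bind_pmf_le[where Q = Q]) (auto simp: reliable_def set_replicate_pmf)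

text \<open>The query bound is real so that estimates stay in real arithmetic; it is rounded down
  only where it meets the extended naturals.\<close>

definition affordable :: "'a set \<Rightarrow> nat \<Rightarrow> real \<Rightarrow> 'a algorithm \<Rightarrow> bool" where
  "affordable X r q A \<longleftrightarrow> 0 \<le> q \<and> queried A \<subseteq> X \<times> X \<and> rounds A \<le> enat r \<and> query_count A \<le> enat (nat \<lfloor>q\<rfloor>)"

lemma affordable_mono: "affordable X r q A \<Longrightarrow> r \<le> r' \<Longrightarrow> q \<le> q' \<Longrightarrow> affordable X r' q' A"
  unfolding affordable_def
  by (meson enat_ord_simps(1) floor_mono nat_mono order_trans)

lemma affordable_Output: "0 \<le> q \<Longrightarrow> affordable X r q (Output S)"
  unfolding affordable_def by (simp flip: zero_enat_def)

lemma affordable_Random: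
  assumes "0 \<le> q" "\<And>x. x \<in> set_pmf p \<Longrightarrow> affordable X r q (f x)"
  shows "affordable X r q (Random (map_pmf f p))"
  using assms unfolding affordable_def by (auto simp: image_image intro!: SUP_least)

lemma affordable_Batch:
  assumes "set qs \<subseteq> X \<times> X" "\<And>as. length as = length qs \<Longrightarrow> affordable X r q (f as)"
  shows "affordable X (Suc r) (real (length qs) + q) (Batch qs f)"
proof -
  \<comment> \<open>Some list of answers always exists, so the bound for the continuation is
    nonnegative.\<close>
  have q: "0 \<le> q" using assms(2)[of "replicate (length qs) True"] by (simp add: affordable_def)
  have fl: "nat \<lfloor>real (length qs) + q\<rfloor> = length qs + nat \<lfloor>q\<rfloor>"
    using q by (simp add: nat_add_distrib add.commute)
  have "(SUP as\<in>{as. length as = length qs}. rounds (f as)) \<le> enat r"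
    using assms(2) by (auto simp: affordable_def intro!: SUP_least)
  then have "rounds (Batch qs f) \<le> enat (Suc r)"
    by (simp add: eSuc_enat[symmetric] plus_1_eSuc)
  moreover have "(SUP as\<in>{as. length as = length qs}. query_count (f as)) \<le> enat (nat \<lfloor>q\<rfloor>)"
    using assms(2) by (auto simp: affordable_def intro!: SUP_least)
  then have "query_count (Batch qs f) \<le> enat (nat \<lfloor>real (length qs) + q\<rfloor>)"
    unfolding fl query_count.simps plus_enat_simps(1)[symmetric] by (rule add_left_mono)
  moreover have "queried (Batch qs f) \<subseteq> X \<times> X"
    using assms by (auto simp: affordable_def)
  ultimately show ?thesis using q by (simp add: affordable_def)
qed

section \<open>Batches of repeated comparisons\<close>

locale tie_breaking =
  fixes X :: "'a set" and idx :: "'a \<Rightarrow> nat"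
  assumes finite_X: "finite X" and inj_idx: "inj_on idx X"
begin

definition beats :: "('a \<Rightarrow> real) \<Rightarrow> 'a \<Rightarrow> 'a \<Rightarrow> bool" where
  "beats v x y \<longleftrightarrow> v x > v y \<or> (v x = v y \<and> idx x > idx y)"

lemma beats_irrefl: "\<not> beats v x x"
  by (simp add: beats_def)

lemma beats_trans: "beats v x y \<Longrightarrow> beats v y z \<Longrightarrow> beats v x z"
  by (auto simp: beats_def)

lemma beats_total: "x \<in> X \<Longrightarrow> y \<in> X \<Longrightarrow> x = y \<or> beats v x y \<or> beats v y x"
  using inj_onD[OF inj_idx, of x y] unfolding beats_def by linarith

text \<open>
  Only the orientation towards the larger index decides the tie-broken order with a single query:
  if \<open>idx x < idx y\<close>, then \<open>beats v x y\<close> is the negation of "y is at least x".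
\<close>

definition cmp_query :: "'a \<times> 'a \<Rightarrow> 'a query" where
  "cmp_query p = (if idx (snd p) < idx (fst p) then p else prod.swap p)"

lemma truth_cmp_query:
  "truth v (cmp_query p) = (idx (snd p) < idx (fst p)) \<longleftrightarrow> beats v (fst p) (snd p)"
  by (auto simp: truth_def cmp_query_def beats_def)

definition vote :: "'a \<times> 'a \<Rightarrow> bool list \<Rightarrow> bool" where
  "vote p as \<longleftrightarrow> length as < 2 * length (filter (\<lambda>a. a = (idx (snd p) < idx (fst p))) as)"

text \<open>Only noise-free positions are constrained. They form a strict majority, so they carry a
  true claim alone, and votes for a false claim come from the remaining minority.\<close>

lemma vote_correct:
  assumes "length as = length ok" "\<not> bad_block ok"
    and "\<And>i. i < length ok \<Longrightarrow> ok ! i \<Longrightarrow> as ! i = truth v (cmp_query p)"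
  shows "vote p as \<longleftrightarrow> beats v (fst p) (snd p)"
proof -
  define Q where "Q a \<longleftrightarrow> a = (idx (snd p) < idx (fst p))" for a
  let ?I = "{..<length ok}"
  have g: "length (filter id ok) = card {i \<in> ?I. ok ! i}"
    and c: "length (filter Q as) = card {i \<in> ?I. Q (as ! i)}"
    by (simp_all add: length_filter_conv_card assms(1) conj_commute lessThan_def)
  have big: "length ok < 2 * card {i \<in> ?I. ok ! i}"
    using assms(2) by (simp add: bad_block_def g)
  have vote: "vote p as \<longleftrightarrow> length ok < 2 * length (filter Q as)"
    unfolding vote_def Q_def assms(1) ..
  show ?thesis
  proof (cases "beats v (fst p) (snd p)")
    case True
    then have "{i \<in> ?I. ok ! i} \<subseteq> {i \<in> ?I. Q (as ! i)}"
      using assms(3) truth_cmp_query[of v p] by (auto simp: Q_def)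
    then have "card {i \<in> ?I. ok ! i} \<le> card {i \<in> ?I. Q (as ! i)}"
      by (intro card_mono) auto
    then show ?thesis using True big c vote by linarith
  next
    case False
    then have "{i \<in> ?I. Q (as ! i)} \<subseteq> ?I - {i \<in> ?I. ok ! i}"
      using assms(3) truth_cmp_query[of v p] by (auto simp: Q_def)
    then have "card {i \<in> ?I. Q (as ! i)} \<le> card (?I - {i \<in> ?I. ok ! i})"
      by (intro card_mono) auto
    also have "\<dots> = length ok - card {i \<in> ?I. ok ! i}"
      by (subst card_Diff_subset) auto
    finally show ?thesis using False big c vote by linarith
  qed
qed

section \<open>Batches of pairs, evaluated by majority\<close>

definition enum :: "'b set \<Rightarrow> 'b list" where
  "enum P = (SOME ps. set ps = P \<and> distinct ps)"

lemma enum: "finite P \<Longrightarrow> set (enum P) = P" "finite P \<Longrightarrow> distinct (enum P)"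
  using someI_ex[OF finite_distinct_list[of P]] by (auto simp: enum_def)

lemma length_enum: "finite P \<Longrightarrow> length (enum P) = card P"
  using enum[of P] distinct_card by metis

definition claims :: "nat \<Rightarrow> ('a \<times> 'a) list \<Rightarrow> bool list \<Rightarrow> ('a \<times> 'a) set" where
  "claims R ps as = {ps ! i | i. i < length ps \<and> vote (ps ! i) (blocks R (length ps) as ! i)}"

lemma claims_subset: "claims R ps as \<subseteq> set ps"
  unfolding claims_def by auto

text \<open>Position \<open>j\<close> of the batch is a repetition for pair number
  \<open>j div R\<close>. The continuation sees the majority decisions only, as a set of
  pairs.\<close>

definition ask :: "nat \<Rightarrow> ('a \<times> 'a) set \<Rightarrow> (('a \<times> 'a) set \<Rightarrow> 'a algorithm) \<Rightarrow> 'a algorithm" where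
  "ask R P F = Batch (map (\<lambda>j. cmp_query (enum P ! (j div R))) [0..<card P * R])
     (\<lambda>as. F (claims R (enum P) as))"

lemma affordable_ask:
  assumes "P \<subseteq> X \<times> X" "\<And>G. G \<subseteq> P \<Longrightarrow> affordable X r q (F G)"
  shows "affordable X (Suc r) (real (card P) * real R + q) (ask R P F)"
proof -
  have fin: "finite P" using assms(1) finite_X by (meson finite_SigmaI finite_subset)
  have "enum P ! (j div R) \<in> P" if "j < card P * R" for j
    using that enum(1)[OF fin] length_enum[OF fin]
    by (metis less_mult_imp_div_less nth_mem)
  moreover have "cmp_query p \<in> X \<times> X" if "p \<in> P" for p
    using that assms(1) by (cases p) (auto simp: cmp_query_def)
  ultimately have "set (map (\<lambda>j. cmp_query (enum P ! (j div R))) [0..<card P * R]) \<subseteq> X \<times> X"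
    by (simp add: image_subset_iff del: mem_Sigma_iff)
  moreover have "claims R (enum P) as \<subseteq> P" for as
    using claims_subset[of R "enum P"] unfolding enum(1)[OF fin] .
  ultimately show ?thesis
    using affordable_Batch[of "map (\<lambda>j. cmp_query (enum P ! (j div R))) [0..<card P * R]" X r q
        "\<lambda>as. F (claims R (enum P) as)"] assms(2)
    by (simp add: ask_def)
qed

lemma claims_correct:
  fixes R P v ok lie
  assumes "finite P" "length ok = card P * R" "i < card P"
    and "\<not> bad_block (blocks R (card P) ok ! i)"
  defines "as \<equiv> noisy_answers v (map (\<lambda>j. cmp_query (enum P ! (j div R))) [0..<card P * R]) ok lie"
  shows "enum P ! i \<in> claims R (enum P) as \<longleftrightarrow> beats v (fst (enum P ! i)) (snd (enum P ! i))"
proof -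
  have len: "length (enum P) = card P" and dist: "distinct (enum P)"
    using enum length_enum assms(1) by auto
  have lenas: "length as = card P * R" by (simp add: as_def noisy_answers_def)
  have fits: "i * R + R \<le> card P * R"
    using assms(3) by (metis Suc_leI add.commute mult_Suc mult_le_mono1)
  have "vote (enum P ! i) (take R (drop (i * R) as)) \<longleftrightarrow>
      beats v (fst (enum P ! i)) (snd (enum P ! i))"
  proof (rule vote_correct[where ok = "take R (drop (i * R) ok)"])
    show "\<not> bad_block (take R (drop (i * R) ok))"
      using assms(3,4) by (simp add: blocks_def)
  next
    fix j assume j: "j < length (take R (drop (i * R) ok))" "take R (drop (i * R) ok) ! j"
    have "i * R \<le> length ok" using fits assms(2) by linarith
    with j have "j < R" "ok ! (i * R + j)" by auto
    moreover have "(i * R + j) div R = i" using \<open>j < R\<close> by simp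
    ultimately show "take R (drop (i * R) as) ! j = truth v (cmp_query (enum P ! i))"
    proof -
      have "i * R + j < card P * R" using \<open>j < R\<close> fits by linarith
      then have "as ! (i * R + j) = truth v (cmp_query (enum P ! i))"
        using \<open>ok ! (i * R + j)\<close> \<open>(i * R + j) div R = i\<close> by (simp add: as_def noisy_answers_def)
      moreover have "i * R \<le> length as" using fits lenas by linarith
      ultimately show ?thesis using \<open>j < R\<close> by simp
    qed
  qed (simp add: lenas assms(2))
  then have *: "vote (enum P ! i) (blocks R (card P) as ! i) \<longleftrightarrow>
      beats v (fst (enum P ! i)) (snd (enum P ! i))"
    using assms(3) by (simp add: blocks_def)
  have "enum P ! i \<in> claims R (enum P) as \<longleftrightarrow> vote (enum P ! i) (blocks R (card P) as ! i)"
    unfolding claims_def len using assms(3) dist len by (auto simp: nth_eq_iff_index_eq)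
  then show ?thesis using * by simp
qed

text \<open>Wrongly decided pairs have bad blocks, but the adversary chooses which bad blocks lead
  to errors. Hence \<open>Q\<close> has to be closed under subsets, and its probability is taken for
  the set of all bad pairs.\<close>

lemma reliable_ask:
  assumes "finite P"
    and "measure_pmf.prob (replicate_pmf (card P) (replicate_pmf R (bernoulli_pmf (2/3))))
      {bs. \<not> Q {enum P ! i | i. i < card P \<and> bad_block (bs ! i)}} \<le> e"
    and "\<And>B B'. Q B \<Longrightarrow> B' \<subseteq> B \<Longrightarrow> Q B'"
    and "\<And>G. G \<subseteq> P \<Longrightarrow> Q {p \<in> P. (p \<in> G) \<noteq> beats v (fst p) (snd p)} \<Longrightarrow> reliable v T \<epsilon> (F G)"
    and "0 \<le> \<epsilon>"
  shows "reliable v T (e + \<epsilon>) (ask R P F)"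
  unfolding ask_def
proof (rule reliable_Batch[where Q =
      "\<lambda>ok. Q {enum P ! i | i. i < card P \<and> bad_block (blocks R (card P) ok ! i)}"])
  show "measure_pmf.prob (replicate_pmf (length (map (\<lambda>j. cmp_query (enum P ! (j div R))) [0..<card P * R]))
       (bernoulli_pmf (2 / 3)))
     {ok. \<not> Q {enum P ! i |i. i < card P \<and> bad_block (blocks R (card P) ok ! i)}} \<le> e"
    using assms(2) by (simp add: map_blocks_replicate_pmf[symmetric] vimage_def)
next
  fix ok lie
  let ?qs = "map (\<lambda>j. cmp_query (enum P ! (j div R))) [0..<card P * R]"
  let ?G = "claims R (enum P) (noisy_answers v ?qs ok lie)"
  assume len: "length ok = length ?qs"
    and Q: "Q {enum P ! i |i. i < card P \<and> bad_block (blocks R (card P) ok ! i)}"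
  have "{p \<in> P. (p \<in> ?G) \<noteq> beats v (fst p) (snd p)}
      \<subseteq> {enum P ! i |i. i < card P \<and> bad_block (blocks R (card P) ok ! i)}"
  proof
    fix p assume p: "p \<in> {p \<in> P. (p \<in> ?G) \<noteq> beats v (fst p) (snd p)}"
    then obtain i where i: "i < card P" "p = enum P ! i"
      using enum(1)[OF assms(1)] length_enum[OF assms(1)] by (metis (mono_tags, lifting) in_set_conv_nth mem_Collect_eq)
    then have "bad_block (blocks R (card P) ok ! i)"
      using claims_correct[OF assms(1), of ok R i v lie] len p by auto
    then show "p \<in> {enum P ! i |i. i < card P \<and> bad_block (blocks R (card P) ok ! i)}"
      using i by blast
  qed
  moreover have "?G \<subseteq> P"
    using claims_subset[of R "enum P"] unfolding enum(1)[OF assms(1)] .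
  ultimately show "reliable v T \<epsilon> (F ?G)"
    by (intro assms(4)) (use assms(3)[OF Q] in blast)+
qed (fact assms(5))

text \<open>A union bound over the pairs in \<open>K\<close> only, so the cost does not depend on
  the size of the batch.\<close>

lemma prob_critical_block:
  assumes "finite P" "K \<subseteq> P"
  shows "measure_pmf.prob (replicate_pmf (card P) (replicate_pmf R (bernoulli_pmf (2/3))))
      {bs. {enum P ! i | i. i < card P \<and> bad_block (bs ! i)} \<inter> K \<noteq> {}} \<le> real (card K) * exp (- real R / 18)"
    (is "measure_pmf.prob ?p _ \<le> _")
proof -
  let ?I = "{i. i < card P \<and> enum P ! i \<in> K}"
  have len: "length (enum P) = card P" and dist: "distinct (enum P)" and set: "set (enum P) = P"
    using enum length_enum assms(1) by auto
  have inj: "inj_on (\<lambda>i. enum P ! i) ?I"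
    using dist len by (auto simp: inj_on_def nth_eq_iff_index_eq)
  have "(\<lambda>i. enum P ! i) ` ?I = K"
    using assms(2) set len by (auto simp: image_iff) (metis in_set_conv_nth subsetD)
  then have card: "card ?I = card K" using card_image[OF inj] by simp
  have "{bs. {enum P ! i | i. i < card P \<and> bad_block (bs ! i)} \<inter> K \<noteq> {}} = {bs. \<exists>i\<in>?I. bad_block (bs ! i)}"
    by auto
  also have "measure_pmf.prob ?p \<dots> \<le> real (card ?I) * exp (- real R / 18)"
  proof (rule prob_union_bound)
    fix i assume "i \<in> ?I"
    then have "measure_pmf.prob ?p {bs. bad_block (bs ! i)} =
        measure_pmf.prob (replicate_pmf R (bernoulli_pmf (2/3))) {b. bad_block b}"
      using map_nth_replicate_pmf[of i "card P" "replicate_pmf R (bernoulli_pmf (2/3))"]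
        measure_map_pmf[of "\<lambda>xs. xs ! i" ?p "{b. bad_block b}"] by (simp add: vimage_def)
    then show "measure_pmf.prob ?p {bs. bad_block (bs ! i)} \<le> exp (- real R / 18)"
      using prob_bad_block by simp
  qed auto
  finally show ?thesis unfolding card .
qed

lemma reliable_ask_all:
  assumes "finite P" "reliable v T \<epsilon> (F {p \<in> P. beats v (fst p) (snd p)})"
  shows "reliable v T (real (card P) * exp (- real R / 18) + \<epsilon>) (ask R P F)"
proof (rule reliable_ask[where Q = "\<lambda>B. B \<inter> P = {}"])
  show "measure_pmf.prob (replicate_pmf (card P) (replicate_pmf R (bernoulli_pmf (2/3))))
      {bs. {enum P ! i | i. i < card P \<and> bad_block (bs ! i)} \<inter> P \<noteq> {}} \<le> real (card P) * exp (- real R / 18)"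
    using prob_critical_block[OF assms(1) order_refl] .
  fix G assume "G \<subseteq> P" "{p \<in> P. (p \<in> G) \<noteq> beats v (fst p) (snd p)} \<inter> P = {}"
  then have "G = {p \<in> P. beats v (fst p) (snd p)}" by blast
  then show "reliable v T \<epsilon> (F G)" using assms(2) by simp
qed (use assms reliable_nonneg in auto)

text \<open>Serves rounds with few repetitions, where some errors are expected: the pairs in
  \<open>K\<close> are protected by a union bound, while the total number of errors is controlled by
  Hoeffding's inequality over the independent blocks.\<close>

lemma reliable_ask_critical:
  assumes "finite P" "K \<subseteq> P" "0 \<le> e" "0 \<le> \<epsilon>" "P \<noteq> {}"
    and "\<And>G. G \<subseteq> P \<Longrightarrow> (\<forall>p\<in>K. p \<in> G \<longleftrightarrow> beats v (fst p) (snd p)) \<Longrightarrow>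
      real (card {p \<in> P. (p \<in> G) \<noteq> beats v (fst p) (snd p)}) \<le> real (card P) * exp (- real R / 18) + e \<Longrightarrow>
      reliable v T \<epsilon> (F G)"
  shows "reliable v T (real (card K) * exp (- real R / 18) + exp (- 2 * e\<^sup>2 / real (card P)) + \<epsilon>) (ask R P F)"
proof (rule reliable_ask[where Q = "\<lambda>B. B \<inter> K = {} \<and> real (card (B \<inter> P)) \<le> real (card P) * exp (- real R / 18) + e"])
  let ?B = "\<lambda>bs. {enum P ! i | i. i < card P \<and> bad_block (bs ! i)}"
  let ?b = "replicate_pmf R (bernoulli_pmf (2/3))"
  let ?p = "replicate_pmf (card P) ?b"
  let ?\<beta> = "measure_pmf.prob ?b {b. bad_block b}"
  have fin: "finite (?B bs)" for bs by simp
  have card_B: "card (?B bs \<inter> P) \<le> length (filter bad_block bs)" if "length bs = card P" for bs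
  proof -
    have "?B bs = (\<lambda>i. enum P ! i) ` {i. i < card P \<and> bad_block (bs ! i)}" by auto
    then have "card (?B bs) \<le> length (filter bad_block bs)"
      using card_image_le[of "{i. i < card P \<and> bad_block (bs ! i)}" "\<lambda>i. enum P ! i"] that
      by (simp add: length_filter_conv_card)
    moreover have "card (?B bs \<inter> P) \<le> card (?B bs)" by (intro card_mono fin) auto
    ultimately show ?thesis by linarith
  qed
  have "measure_pmf.prob ?p {bs. real (card P) * exp (- real R / 18) + e < real (card (?B bs \<inter> P))}
      \<le> measure_pmf.prob ?p {bs. real (card P) * ?\<beta> + e \<le> real (length (filter bad_block bs))}"
  proof (rule measure_pmf.finite_measure_mono_AE)
    show "AE bs in measure_pmf ?p. bs \<in> {bs. real (card P) * exp (- real R / 18) + e < real (card (?B bs \<inter> P))} \<longrightarrow>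
      bs \<in> {bs. real (card P) * ?\<beta> + e \<le> real (length (filter bad_block bs))}"
    proof (rule AE_pmfI, safe)
      fix bs assume "bs \<in> set_pmf ?p" and *: "real (card P) * exp (- real R / 18) + e < real (card (?B bs \<inter> P))"
      then have "card (?B bs \<inter> P) \<le> length (filter bad_block bs)"
        by (intro card_B) (simp add: set_replicate_pmf)
      moreover have "real (card P) * ?\<beta> \<le> real (card P) * exp (- real R / 18)"
        using prob_bad_block by (intro mult_left_mono) auto
      ultimately show "real (card P) * ?\<beta> + e \<le> real (length (filter bad_block bs))" using * by linarith
    qed
  qed simp
  also have "\<dots> \<le> exp (- 2 * e\<^sup>2 / real (card P))"
    using assms(1,3,5) by (intro filter_count_ge) (auto simp: card_gt_0_iff)
  finally have 1: "measure_pmf.prob ?p {bs. real (card P) * exp (- real R / 18) + e < real (card (?B bs \<inter> P))}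
     \<le> exp (- 2 * e\<^sup>2 / real (card P))" .
  have "measure_pmf.prob ?p {bs. \<not> (?B bs \<inter> K = {} \<and> real (card (?B bs \<inter> P)) \<le> real (card P) * exp (- real R / 18) + e)}
    \<le> measure_pmf.prob ?p ({bs. ?B bs \<inter> K \<noteq> {}} \<union> {bs. real (card P) * exp (- real R / 18) + e < real (card (?B bs \<inter> P))})"
    by (rule measure_pmf.finite_measure_mono) auto
  also have "\<dots> \<le> measure_pmf.prob ?p {bs. ?B bs \<inter> K \<noteq> {}} +
      measure_pmf.prob ?p {bs. real (card P) * exp (- real R / 18) + e < real (card (?B bs \<inter> P))}"
    by (rule measure_Un_le) auto
  also have "\<dots> \<le> real (card K) * exp (- real R / 18) + exp (- 2 * e\<^sup>2 / real (card P))"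
    using 1 prob_critical_block[OF assms(1,2)] by (rule add_mono[rotated])
  finally show "measure_pmf.prob ?p {bs. \<not> (?B bs \<inter> K = {} \<and> real (card (?B bs \<inter> P)) \<le> real (card P) * exp (- real R / 18) + e)}
    \<le> real (card K) * exp (- real R / 18) + exp (- 2 * e\<^sup>2 / real (card P))" .
next
  fix B B' assume B: "B \<inter> K = {} \<and> real (card (B \<inter> P)) \<le> real (card P) * exp (- real R / 18) + e" "B' \<subseteq> B"
  then have "card (B' \<inter> P) \<le> card (B \<inter> P)" using assms(1) by (intro card_mono) auto
  then show "B' \<inter> K = {} \<and> real (card (B' \<inter> P)) \<le> real (card P) * exp (- real R / 18) + e"
    using B by auto
next
  fix G assume G: "G \<subseteq> P" and Q: "{p \<in> P. (p \<in> G) \<noteq> beats v (fst p) (snd p)} \<inter> K = {} \<and>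
    real (card ({p \<in> P. (p \<in> G) \<noteq> beats v (fst p) (snd p)} \<inter> P)) \<le> real (card P) * exp (- real R / 18) + e"
  moreover have "{p \<in> P. (p \<in> G) \<noteq> beats v (fst p) (snd p)} \<inter> P = {p \<in> P. (p \<in> G) \<noteq> beats v (fst p) (snd p)}" by auto
  ultimately show "reliable v T \<epsilon> (F G)" using assms(2) by (intro assms(6)) auto
qed (fact assms)+

end

section \<open>Ranks and random samples\<close>

lemma length_filter_mono:
  "(\<And>x. x \<in> set xs \<Longrightarrow> P x \<Longrightarrow> Q x) \<Longrightarrow> length (filter P xs) \<le> length (filter Q xs)"
  by (induction xs) (auto simp: le_SucI)

context tie_breaking
begin

definition rank :: "('a \<Rightarrow> real) \<Rightarrow> 'a set \<Rightarrow> 'a \<Rightarrow> nat" where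
  "rank v M x = card {y \<in> M. beats v y x}"

definition topset :: "('a \<Rightarrow> real) \<Rightarrow> nat \<Rightarrow> 'a set \<Rightarrow> 'a set" where
  "topset v k M = {x \<in> M. rank v M x < k}"

lemma finite_sub: "M \<subseteq> X \<Longrightarrow> finite M"
  using finite_X finite_subset by blast

lemma rank_less:
  assumes "M \<subseteq> X" "x \<in> M" "beats v x y"
  shows "rank v M x < rank v M y"
proof -
  have "{z \<in> M. beats v z x} \<subset> {z \<in> M. beats v z y}"
    using assms beats_trans beats_irrefl by blast
  then show ?thesis
    unfolding rank_def using finite_sub[OF assms(1)] by (intro psubset_card_mono) auto
qed

lemma rank_less_iff:
  assumes "M \<subseteq> X" "x \<in> M" "y \<in> M"
  shows "rank v M x < rank v M y \<longleftrightarrow> beats v x y"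
  using rank_less[of M x v y] rank_less[of M y v x] beats_total[of x y v] assms by fastforce

text \<open>A strict total order makes ranks injective, and an injection into a set of the same
  finite size is onto.\<close>

lemma bij_rank:
  assumes "M \<subseteq> X"
  shows "bij_betw (rank v M) M {..<card M}"
proof -
  have inj: "inj_on (rank v M) M"
    using rank_less_iff[OF assms] beats_total assms unfolding inj_on_def
    by (metis less_irrefl subsetD)
  have "rank v M x < card M" if "x \<in> M" for x
  proof -
    have "{y \<in> M. beats v y x} \<subset> M" using that beats_irrefl by blast
    then show ?thesis unfolding rank_def using finite_sub[OF assms] by (intro psubset_card_mono)
  qed
  then have "rank v M ` M \<subseteq> {..<card M}" by auto
  moreover have "card (rank v M ` M) = card {..<card M}" using inj by (simp add: card_image)
  ultimately have "rank v M ` M = {..<card M}" by (intro card_subset_eq) auto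
  then show ?thesis using inj by (simp add: bij_betw_def)
qed

lemma card_topset:
  assumes "M \<subseteq> X" "k \<le> card M"
  shows "card (topset v k M) = k"
proof -
  have "rank v M ` topset v k M = {..<k}"
  proof
    show "{..<k} \<subseteq> rank v M ` topset v k M"
    proof
      fix i assume i: "i \<in> {..<k}"
      then have "i \<in> rank v M ` M" using bij_rank[OF assms(1)] assms(2) by (auto simp: bij_betw_def)
      then show "i \<in> rank v M ` topset v k M" using i by (auto simp: topset_def)
    qed
  qed (auto simp: topset_def)
  moreover have "inj_on (rank v M) (topset v k M)"
    using bij_rank[OF assms(1)] by (auto simp: bij_betw_def topset_def intro: inj_on_subset)
  ultimately show ?thesis by (metis card_image card_lessThan)
qed

lemma topset_upward:
  assumes "M \<subseteq> X" "x \<in> topset v k M" "y \<in> M" "beats v y x"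
  shows "y \<in> topset v k M"
  using rank_less[OF assms(1,3,4)] assms by (auto simp: topset_def)

text \<open>A member of an upward closed \<open>U\<close> is beaten only by other members of
  \<open>U\<close>, hence has rank below \<open>card U\<close>; a non-member is beaten by all of
  \<open>U\<close>.\<close>

lemma upward_eq_topset:
  assumes "M \<subseteq> X" "U \<subseteq> M" "\<And>x y. x \<in> U \<Longrightarrow> y \<in> M \<Longrightarrow> beats v y x \<Longrightarrow> y \<in> U"
  shows "U = topset v (card U) M"
proof -
  have fin: "finite U" using assms finite_sub by blast
  have "rank v M x < card U \<longleftrightarrow> x \<in> U" if "x \<in> M" for x
  proof
    assume "x \<in> U"
    then have "{y \<in> M. beats v y x} \<subset> U" using assms(3) beats_irrefl by blast
    then show "rank v M x < card U" unfolding rank_def using fin by (intro psubset_card_mono)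
  next
    assume less: "rank v M x < card U"
    show "x \<in> U"
    proof (rule ccontr)
      assume "x \<notin> U"
      then have "U \<subseteq> {y \<in> M. beats v y x}"
        using assms that beats_total by blast
      then have "card U \<le> rank v M x"
        unfolding rank_def using finite_sub[OF assms(1)] by (intro card_mono) auto
      then show False using less by simp
    qed
  qed
  then show ?thesis using assms(2) by (auto simp: topset_def)
qed

text \<open>Breaking ties only refines the order: an outside element of strictly larger value would
  beat a member and hence belong to the set.\<close>

lemma is_top_k_topset:
  assumes "k \<le> card X"
  shows "is_top_k v X k (topset v k X)"
  unfolding is_top_k_def
  using card_topset[OF order_refl assms] topset_upward[OF order_refl, of _ v k]
  by (auto simp: topset_def beats_def)

text \<open>The state of a partial computation: \<open>A\<close> has been accepted and \<open>M\<close> is undecided.\<close>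

definition straddles :: "'a set \<Rightarrow> 'a set \<Rightarrow> 'a set \<Rightarrow> bool" where
  "straddles T A M \<longleftrightarrow> A \<subseteq> T \<and> T \<subseteq> A \<union> M \<and> A \<inter> M = {} \<and> A \<union> M \<subseteq> X"

text \<open>The missing part of the target is upward closed in \<open>M\<close>, so what remains is
  a problem of the same kind on the candidates alone.\<close>

lemma straddles_topset:
  assumes "straddles (topset v k X) A M" "k \<le> card X"
  shows "topset v k X - A = topset v (k - card A) M" "k - card A \<le> card M"
proof -
  let ?T = "topset v k X"
  have fin: "finite A" "finite M" "finite ?T"
    using assms(1) finite_sub by (auto simp: straddles_def topset_def)
  have card: "card (?T - A) = k - card A"
    using assms card_topset[OF order_refl assms(2)] fin
    by (subst card_Diff_subset) (auto simp: straddles_def)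
  have "?T - A = topset v (card (?T - A)) M"
    using assms(1) topset_upward[OF order_refl, of _ v k]
    by (intro upward_eq_topset) (auto simp: straddles_def)
  then show "?T - A = topset v (k - card A) M" unfolding card .
  have "card (?T - A) \<le> card M" using assms(1) fin by (intro card_mono) (auto simp: straddles_def)
  then show "k - card A \<le> card M" unfolding card .
qed

section \<open>Rank estimates from a random sample\<close>

definition above :: "('a \<Rightarrow> real) \<Rightarrow> 'a list \<Rightarrow> 'a \<Rightarrow> nat" where
  "above v xs x = length (filter (\<lambda>y. beats v y x) xs)"

text \<open>
  An element of \<open>M\<close> with rank about \<open>\<kappa>\<close> has about \<open>s * \<kappa> / N\<close> elements of a sample of size \<open>s\<close>
  above it; \<open>d\<close> is the tolerated deviation. Elements with fewer than \<open>low_cut\<close> sample elements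
  above them are accepted, those with at least \<open>high_cut\<close> are rejected.
\<close>

definition low_cut :: "nat \<Rightarrow> real \<Rightarrow> nat \<Rightarrow> nat \<Rightarrow> nat" where
  "low_cut s d \<kappa> N = nat \<lceil>real s * real \<kappa> / real N - d\<rceil>"

definition high_cut :: "nat \<Rightarrow> real \<Rightarrow> nat \<Rightarrow> nat \<Rightarrow> nat" where
  "high_cut s d \<kappa> N = nat \<lfloor>real s * real \<kappa> / real N + d\<rfloor> + 1"

lemma low_cut_le_iff: "low_cut s d \<kappa> N \<le> c \<longleftrightarrow> real s * real \<kappa> / real N - d \<le> real c"
  unfolding low_cut_def by (simp add: ceiling_le_iff nat_le_iff)

text \<open>The added 1 makes the inequality strict. Nonnegativity of \<open>d\<close> ensures that
  \<open>nat\<close> does not truncate the floor.\<close>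

lemma high_cut_le_iff:
  assumes "0 \<le> d"
  shows "high_cut s d \<kappa> N \<le> c \<longleftrightarrow> real s * real \<kappa> / real N + d < real c"
proof -
  have "high_cut s d \<kappa> N \<le> c \<longleftrightarrow> nat \<lfloor>real s * real \<kappa> / real N + d\<rfloor> < c"
    unfolding high_cut_def by linarith
  also have "\<dots> \<longleftrightarrow> \<lfloor>real s * real \<kappa> / real N + d\<rfloor> < int c"
    using assms by (simp add: nat_less_iff)
  also have "\<dots> \<longleftrightarrow> real s * real \<kappa> / real N + d < real c"
    by (simp add: floor_less_iff)
  finally show ?thesis .
qed

definition good_sample :: "('a \<Rightarrow> real) \<Rightarrow> nat \<Rightarrow> real \<Rightarrow> nat \<Rightarrow> 'a set \<Rightarrow> 'a list \<Rightarrow> bool" where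
  "good_sample v s d \<kappa> M xs \<longleftrightarrow>
     (\<forall>x\<in>M. above v xs x < low_cut s d \<kappa> (card M) \<longrightarrow> rank v M x < \<kappa>) \<and>
     (\<forall>x\<in>M. rank v M x < \<kappa> \<longrightarrow> above v xs x < high_cut s d \<kappa> (card M)) \<and>
     real (card {x \<in> M. low_cut s d \<kappa> (card M) \<le> above v xs x \<and> above v xs x < high_cut s d \<kappa> (card M)})
       \<le> 4 * d * real (card M) / real s + 2"

text \<open>Since \<open>above\<close> is monotone in the rank, accurate counts at the three
  thresholds \<open>\<kappa>\<close> and \<open>\<kappa>\<close> plus or minus \<open>w\<close>
  suffice. A shift by \<open>w\<close> ranks moves the expected count by more than
  \<open>2 * d\<close>, so undecided elements have ranks within \<open>w\<close> of
  \<open>\<kappa>\<close>; ranks being distinct, there are at most \<open>2 * w\<close> of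
  them.\<close>

lemma good_sampleI:
  fixes M v xs
  defines "N \<equiv> card M" and "cnt \<equiv> \<lambda>t. real (length (filter (\<lambda>y. rank v M y < t) xs))"
  assumes M: "M \<subseteq> X" "M \<noteq> {}" and s: "s > 0" and d: "0 \<le> d" and xs: "set xs \<subseteq> M"
    and w: "w = nat \<lfloor>2 * d * real N / real s\<rfloor> + 1"
    and ev: "\<And>t. t \<in> {\<kappa>, min N (\<kappa> + w), \<kappa> - w} \<Longrightarrow> \<bar>cnt t - real s * (real t / real N)\<bar> < d"
  shows "good_sample v s d \<kappa> M xs"
proof -
  let ?m = "real s * real \<kappa> / real N"
  have N: "N > 0" using M finite_sub by (auto simp: N_def card_gt_0_iff)
  have lower: "cnt t \<le> real (above v xs x)" if "x \<in> M" "t \<le> rank v M x" for x t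
    unfolding cnt_def above_def
  proof (intro of_nat_mono length_filter_mono)
    fix y assume "y \<in> set xs" "rank v M y < t"
    then show "beats v y x" using that xs rank_less_iff[OF M(1), of y x v] by auto
  qed
  have upper: "real (above v xs x) \<le> cnt t" if "x \<in> M" "rank v M x < t" for x t
    unfolding cnt_def above_def
  proof (intro of_nat_mono length_filter_mono)
    fix y assume "y \<in> set xs" "beats v y x"
    then show "rank v M y < t" using that xs rank_less[OF M(1), of y v x] by auto
  qed
  have k: "\<bar>cnt \<kappa> - ?m\<bar> < d" using ev[of \<kappa>] by simp
  have wbig: "2 * d < real s * real w / real N"
  proof -
    have "2 * d * real N / real s < real w"
      unfolding w using d by (simp add: nat_less_real_le) linarith
    then show ?thesis using s N by (simp add: field_simps)
  qed
  have wle: "real w \<le> 2 * d * real N / real s + 1"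
    unfolding w using d by simp
  have mid: "\<kappa> - w \<le> rank v M x \<and> rank v M x < \<kappa> + w"
    if x: "x \<in> M" and c: "low_cut s d \<kappa> N \<le> above v xs x" "above v xs x < high_cut s d \<kappa> N" for x
  proof
    have c': "?m - d \<le> real (above v xs x)" "real (above v xs x) \<le> ?m + d"
      using c low_cut_le_iff[of s d \<kappa> N] high_cut_le_iff[OF d, of s \<kappa> N "above v xs x"] by auto
    show "\<kappa> - w \<le> rank v M x"
    proof (rule ccontr)
      assume neg: "\<not> \<kappa> - w \<le> rank v M x"
      \<comment> \<open>A rank below \<open>\<kappa> - w\<close> shows that the subtraction of
        naturals is not truncated.\<close>
      then have "real (\<kappa> - w) = real \<kappa> - real w" by simp
      then have "real s * (real (\<kappa> - w) / real N) = ?m - real s * real w / real N"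
        by (simp add: right_diff_distrib diff_divide_distrib)
      moreover have "\<bar>cnt (\<kappa> - w) - real s * (real (\<kappa> - w) / real N)\<bar> < d"
        using ev[of "\<kappa> - w"] by simp
      moreover have "real (above v xs x) \<le> cnt (\<kappa> - w)" using neg x by (intro upper) auto
      ultimately show False using wbig c' by linarith
    qed
    show "rank v M x < \<kappa> + w"
    proof (rule ccontr)
      \<comment> \<open>Ranks stay below \<open>N\<close>, so in this case the cap in
        \<open>min N (\<kappa> + w)\<close> is inactive.\<close>
      assume neg: "\<not> rank v M x < \<kappa> + w"
      moreover have "rank v M x < N" using bij_rank[OF M(1)] x by (auto simp: bij_betw_def N_def)
      ultimately have mn: "min N (\<kappa> + w) = \<kappa> + w" by simp
      have "real s * (real (\<kappa> + w) / real N) = ?m + real s * real w / real N"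
        by (simp add: ring_distribs add_divide_distrib)
      moreover have "\<bar>cnt (\<kappa> + w) - real s * (real (\<kappa> + w) / real N)\<bar> < d"
        using ev[of "\<kappa> + w"] mn by simp
      moreover have "cnt (\<kappa> + w) \<le> real (above v xs x)" using neg x by (intro lower) auto
      ultimately show False using wbig c' by linarith
    qed
  qed
  let ?C = "{x \<in> M. low_cut s d \<kappa> N \<le> above v xs x \<and> above v xs x < high_cut s d \<kappa> N}"
  have "card ?C \<le> card {\<kappa> - w..<\<kappa> + w}"
  proof (rule card_inj_on_le[of "rank v M"])
    show "inj_on (rank v M) ?C"
      using bij_rank[OF M(1)] by (auto simp: bij_betw_def intro: inj_on_subset)
    show "rank v M ` ?C \<subseteq> {\<kappa> - w..<\<kappa> + w}" using mid by auto
  qed simp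
  also have "\<dots> \<le> 2 * w" by simp
  finally have "real (card ?C) \<le> 2 * real w" by linarith
  then have "real (card ?C) \<le> 4 * d * real N / real s + 2" using wle by linarith
  moreover have "rank v M x < \<kappa>" if "x \<in> M" "above v xs x < low_cut s d \<kappa> N" for x
  proof (rule ccontr)
    assume "\<not> rank v M x < \<kappa>"
    then have "cnt \<kappa> \<le> real (above v xs x)" using that by (intro lower) auto
    then show False using that(2) low_cut_le_iff[of s d \<kappa> N "above v xs x"] k by linarith
  qed
  moreover have "above v xs x < high_cut s d \<kappa> N" if "x \<in> M" "rank v M x < \<kappa>" for x
    using upper[OF that] high_cut_le_iff[OF d, of s \<kappa> N "above v xs x"] k by linarith
  ultimately show ?thesis unfolding good_sample_def N_def by blast
qed

text \<open>Two-sided Hoeffding at three thresholds gives the factor 6. The cap at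
  \<open>card M\<close> makes \<open>t / card M\<close> the exact probability of a rank below
  \<open>t\<close>.\<close>

lemma prob_good_sample:
  assumes M: "M \<subseteq> X" "M \<noteq> {}" and s: "s > 0" and d: "0 \<le> d" and "\<kappa> \<le> card M"
  shows "measure_pmf.prob (replicate_pmf s (pmf_of_set M)) {xs. \<not> good_sample v s d \<kappa> M xs}
    \<le> 6 * exp (- 2 * d\<^sup>2 / real s)" (is "measure_pmf.prob ?p _ \<le> _")
proof -
  define N where "N = card M"
  define w where "w = nat \<lfloor>2 * d * real N / real s\<rfloor> + 1"
  let ?dev = "\<lambda>t xs. d \<le> \<bar>real (length (filter (\<lambda>y. rank v M y < t) xs)) - real s * (real t / real N)\<bar>"
  let ?I = "{\<kappa>, min N (\<kappa> + w), \<kappa> - w}"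
  have fin: "finite M" using M finite_sub by blast
  have "measure_pmf.prob ?p {xs. \<not> good_sample v s d \<kappa> M xs} \<le>
      measure_pmf.prob ?p {xs. \<exists>t\<in>?I. ?dev t xs}"
  proof (rule measure_pmf.finite_measure_mono_AE)
    show "AE xs in measure_pmf ?p. xs \<in> {xs. \<not> good_sample v s d \<kappa> M xs} \<longrightarrow> xs \<in> {xs. \<exists>t\<in>?I. ?dev t xs}"
    proof (rule AE_pmfI, rule impI, rule ccontr)
      fix xs assume xs: "xs \<in> set_pmf ?p" and "xs \<in> {xs. \<not> good_sample v s d \<kappa> M xs}"
        and *: "xs \<notin> {xs. \<exists>t\<in>?I. ?dev t xs}"
      moreover have "set xs \<subseteq> M" using xs fin M by (auto simp: set_replicate_pmf)
      moreover have "\<not> ?dev t xs" if "t \<in> ?I" for t using * that by blast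
      ultimately show False
        using good_sampleI[OF M s d, of xs w \<kappa> v] by (auto simp: w_def N_def not_le)
    qed
  qed simp
  also have "\<dots> \<le> real (card ?I) * (2 * exp (- 2 * d\<^sup>2 / real s))"
  proof (rule prob_union_bound)
    fix t assume "t \<in> ?I"
    then have t: "t \<le> N" using assms(5) by (auto simp: N_def)
    have "measure_pmf.prob (pmf_of_set M) {y. rank v M y < t} = real t / real N"
    proof -
      have "M \<inter> {y. rank v M y < t} = topset v t M" by (auto simp: topset_def)
      then show ?thesis
        using M fin t card_topset[OF M(1), of t v] by (simp add: measure_pmf_of_set N_def)
    qed
    then show "measure_pmf.prob ?p {xs. ?dev t xs} \<le> 2 * exp (- 2 * d\<^sup>2 / real s)"
      using filter_count_abs_ge[OF s d, of "pmf_of_set M" "\<lambda>y. rank v M y < t"] by simp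
  qed simp
  also have "\<dots> \<le> 3 * (2 * exp (- 2 * d\<^sup>2 / real s))"
  proof (rule mult_right_mono)
    have "card ?I \<le> 3"
      using card_insert_le_m1[of 3 "{min N (\<kappa> + w), \<kappa> - w}" \<kappa>] card_insert_le_m1[of 2 "{\<kappa> - w}" "min N (\<kappa> + w)"]
      by simp
    then show "real (card ?I) \<le> 3" by linarith
  qed simp
  finally show ?thesis by simp
qed

lemma straddles_split:
  assumes "straddles (topset v k X) A M" "k \<le> card X" "\<kappa> = k - card A" "good_sample v s d \<kappa> M xs"
  shows "straddles (topset v k X) (A \<union> {x \<in> M. above v xs x < low_cut s d \<kappa> (card M)})
    {x \<in> M. low_cut s d \<kappa> (card M) \<le> above v xs x \<and> above v xs x < high_cut s d \<kappa> (card M)}"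
proof -
  have T: "topset v k X - A = topset v \<kappa> M"
    using straddles_topset(1)[OF assms(1,2)] assms(3) by simp
  have 1: "x \<in> topset v k X" if "x \<in> M" "above v xs x < low_cut s d \<kappa> (card M)" for x
    using T that assms(4) by (auto simp: good_sample_def topset_def)
  have 2: "x \<in> M \<and> above v xs x < high_cut s d \<kappa> (card M)" if "x \<in> topset v k X" "x \<notin> A" for x
  proof -
    have "x \<in> topset v \<kappa> M" using T that by blast
    then show ?thesis using assms(4) by (auto simp: good_sample_def topset_def)
  qed
  show ?thesis using assms(1) 1 2 unfolding straddles_def by (auto simp: not_le)
qed

text \<open>
  The \<open>j\<close>-th largest element of the sample \<open>xs\<close> (counted with multiplicity, from 1), provided that
  \<open>G\<close> is the true order on \<open>xs\<close>; the fallback \<open>hd xs\<close> keeps all queries inside \<open>X\<close>.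
\<close>

definition pivot :: "('a \<times> 'a) set \<Rightarrow> 'a list \<Rightarrow> nat \<Rightarrow> 'a" where
  "pivot G xs j = (let Q = \<lambda>p. p \<in> set xs \<and> length (filter (\<lambda>y. (y, p) \<in> G) xs) < j \<and>
       j \<le> length (filter (\<lambda>y. (p, y) \<notin> G) xs)
     in if \<exists>p. Q p then SOME p. Q p else hd xs)"

lemma pivot_in_set: "xs \<noteq> [] \<Longrightarrow> pivot G xs j \<in> set xs"
  unfolding pivot_def Let_def by (auto intro: someI2)

text \<open>The witness is the largest sample element with at least \<open>j\<close> sample elements
  at or above it; the smallest sample element shows that there is one. If \<open>j\<close> were
  strictly above it, the smallest of those would be a larger candidate.\<close>

lemma pivot_exists:
  assumes "set xs \<subseteq> X" "1 \<le> j" "j \<le> length xs"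
  shows "\<exists>p\<in>set xs. above v xs p < j \<and> j \<le> length (filter (\<lambda>y. \<not> beats v p y) xs)"
proof -
  let ?c = "\<lambda>p. length (filter (\<lambda>y. \<not> beats v p y) xs)"
  let ?S = "{p \<in> set xs. j \<le> ?c p}"
  have r: "rank v X x < rank v X y \<longleftrightarrow> beats v x y" if "x \<in> set xs" "y \<in> set xs" for x y
    using that assms(1) by (intro rank_less_iff) auto
  have ex_max: "\<exists>m\<in>S. \<forall>y\<in>S. f y \<le> f m" if "finite S" "S \<noteq> {}" for S and f :: "'a \<Rightarrow> nat"
    using obtains_MAX[OF that, of f] Max_ge[of "f ` S"] that(1) by (metis finite_imageI imageI)
  have "xs \<noteq> []" using assms by auto
  then obtain m where m: "m \<in> set xs" "\<And>y. y \<in> set xs \<Longrightarrow> rank v X y \<le> rank v X m"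
    using ex_max[of "set xs" "rank v X"] by auto
  have "\<not> beats v m y" if "y \<in> set xs" for y
    using m(2)[OF that] r[OF m(1) that] by simp
  then have "filter (\<lambda>y. \<not> beats v m y) xs = xs" by (simp add: filter_id_conv)
  then have "m \<in> ?S" using m assms(3) by simp
  then obtain p where p: "p \<in> ?S" "\<And>q. q \<in> ?S \<Longrightarrow> rank v X p \<le> rank v X q"
    using ex_has_least_nat[of "\<lambda>q. q \<in> ?S" m "rank v X"] by blast
  have "above v xs p < j"
  proof (rule ccontr)
    assume big: "\<not> above v xs p < j"
    let ?U = "{y \<in> set xs. beats v y p}"
    have "?U \<noteq> {}"
    proof
      assume "?U = {}"
      then have "above v xs p = 0" by (auto simp: above_def filter_empty_conv)
      then show False using big assms(2) by simp
    qed
    then obtain q where q: "q \<in> ?U" "\<And>y. y \<in> ?U \<Longrightarrow> rank v X y \<le> rank v X q"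
      using ex_max[of ?U "rank v X"] by auto
    have "above v xs p \<le> ?c q"
      unfolding above_def
    proof (rule length_filter_mono)
      fix y assume y: "y \<in> set xs" "beats v y p"
      then show "\<not> beats v q y" using q(2)[of y] q(1) r[of q y] by auto
    qed
    then have "q \<in> ?S" using q big by simp
    then have "rank v X p \<le> rank v X q" by (rule p(2))
    then show False using q(1) r[of q p] p(1) by auto
  qed
  then show ?thesis using p(1) by blast
qed

text \<open>Replaces counting sample elements above \<open>x\<close> by a single comparison, which
  is what makes pivots cheaper than comparing with the whole sample.\<close>

lemma pivot_spec:
  fixes xs v j
  defines "p \<equiv> pivot {q \<in> set xs \<times> set xs. beats v (fst q) (snd q)} xs j"
  assumes "set xs \<subseteq> X" "1 \<le> j" "j \<le> length xs" "x \<in> X"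
  shows "beats v p x \<longleftrightarrow> j \<le> above v xs x"
proof -
  let ?G = "{q \<in> set xs \<times> set xs. beats v (fst q) (snd q)}"
  define Q where "Q p \<longleftrightarrow> p \<in> set xs \<and> length (filter (\<lambda>y. (y, p) \<in> ?G) xs) < j \<and>
       j \<le> length (filter (\<lambda>y. (p, y) \<notin> ?G) xs)" for p
  have Q_iff: "Q p \<longleftrightarrow> p \<in> set xs \<and> above v xs p < j \<and> j \<le> length (filter (\<lambda>y. \<not> beats v p y) xs)" for p
  proof (cases "p \<in> set xs")
    case True
    have "filter (\<lambda>y. (y, p) \<in> ?G) xs = filter (\<lambda>y. beats v y p) xs"
      "filter (\<lambda>y. (p, y) \<notin> ?G) xs = filter (\<lambda>y. \<not> beats v p y) xs"
      using True by (auto intro: filter_cong)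
    then show ?thesis by (simp add: Q_def above_def)
  qed (simp add: Q_def)
  obtain p0 where "Q p0" using pivot_exists[OF assms(2-4)] Q_iff by blast
  then have "Q p"
    unfolding p_def pivot_def Let_def Q_def[symmetric] by (auto intro: someI)
  then have p: "p \<in> set xs" "above v xs p < j" "j \<le> length (filter (\<lambda>y. \<not> beats v p y) xs)"
    using Q_iff by auto
  show ?thesis
  proof
    assume b: "beats v p x"
    have "length (filter (\<lambda>y. \<not> beats v p y) xs) \<le> above v xs x"
      unfolding above_def
    proof (rule length_filter_mono)
      fix y assume "y \<in> set xs" "\<not> beats v p y"
      then show "beats v y x" using b beats_total[of p y v] p(1) assms(2) beats_trans by blast
    qed
    then show "j \<le> above v xs x" using p(3) by simp
  next
    assume j: "j \<le> above v xs x"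
    show "beats v p x"
    proof (rule ccontr)
      assume "\<not> beats v p x"
      then have "x = p \<or> beats v x p" using beats_total[of p x v] p(1) assms(2,5) by blast
      then have "above v xs x \<le> above v xs p"
        unfolding above_def using beats_trans by (intro length_filter_mono) blast
      then show False using j p(2) by simp
    qed
  qed
qed

end

section \<open>Refining the set of candidates\<close>

context tie_breaking
begin

lemma affordable_ask_le:
  assumes "P \<subseteq> X \<times> X" "\<And>G. G \<subseteq> P \<Longrightarrow> affordable X r q (F G)"
    and "real (card P) * real R + q \<le> q'"
  shows "affordable X (Suc r) q' (ask R P F)"
  using affordable_mono[OF affordable_ask[OF assms(1,2)] order_refl assms(3)] .

definition all_pairs :: "nat \<Rightarrow> nat \<Rightarrow> 'a set \<Rightarrow> 'a set \<Rightarrow> 'a algorithm" where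
  "all_pairs R k A M = ask R (M \<times> M)
     (\<lambda>G. Output (A \<union> {x \<in> M. card {y \<in> M. (y, x) \<in> G} < k - card A}))"

text \<open>Sampling requires a nonempty \<open>M\<close>; for an empty one the accepted set is
  already the answer.\<close>

definition refine_direct :: "nat \<Rightarrow> nat \<Rightarrow> real \<Rightarrow> nat \<Rightarrow> ('a set \<Rightarrow> 'a set \<Rightarrow> 'a algorithm) \<Rightarrow>
    'a set \<Rightarrow> 'a set \<Rightarrow> 'a algorithm" where
  "refine_direct R s d k F A M = (if M = {} then Output A else
     let l = low_cut s d (k - card A) (card M); u = high_cut s d (k - card A) (card M) in
     Random (map_pmf (\<lambda>xs. ask R (set xs \<times> M) (\<lambda>G.
       let c = (\<lambda>x. length (filter (\<lambda>y. (y, x) \<in> G) xs)) in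
       F (A \<union> {x \<in> M. c x < l}) {x \<in> M. l \<le> c x \<and> c x < u}))
     (replicate_pmf s (pmf_of_set M))))"

text \<open>Encodes \<open>j \<le> above v xs x\<close> also where no pivot exists: always true for
  \<open>j = 0\<close>, never for \<open>j > s\<close>.\<close>

definition pivot_test :: "nat \<Rightarrow> ('a \<times> 'a) set \<Rightarrow> (nat \<Rightarrow> 'a) \<Rightarrow> nat \<Rightarrow> 'a \<Rightarrow> bool" where
  "pivot_test s H p j x \<longleftrightarrow> j = 0 \<or> (j \<le> s \<and> (p j, x) \<in> H)"

definition refine_pivot :: "nat \<Rightarrow> nat \<Rightarrow> real \<Rightarrow> nat \<Rightarrow> ('a set \<Rightarrow> 'a set \<Rightarrow> 'a algorithm) \<Rightarrow>
    'a set \<Rightarrow> 'a set \<Rightarrow> 'a algorithm" where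
  "refine_pivot R s d k F A M = (if M = {} then Output A else
     let l = low_cut s d (k - card A) (card M); u = high_cut s d (k - card A) (card M) in
     Random (map_pmf (\<lambda>xs. ask R (set xs \<times> set xs) (\<lambda>G.
       let p = pivot G xs in
       ask R ({p l, p u} \<times> M) (\<lambda>H.
         F (A \<union> {x \<in> M. \<not> pivot_test s H p l x})
           {x \<in> M. pivot_test s H p l x \<and> \<not> pivot_test s H p u x})))
     (replicate_pmf s (pmf_of_set M))))"

section \<open>Cost and reliability of the refinement steps\<close>

lemma affordable_all_pairs:
  assumes "M \<subseteq> X"
  shows "affordable X 1 ((real (card M))\<^sup>2 * real R) (all_pairs R k A M)"
proof -
  have "affordable X (Suc 0) (real (card (M \<times> M)) * real R + 0) (all_pairs R k A M)"
    unfolding all_pairs_def using assms by (intro affordable_ask affordable_Output) auto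
  then show ?thesis using finite_sub[OF assms] by (simp add: card_cartesian_product power2_eq_square)
qed

lemma reliable_all_pairs:
  assumes "straddles (topset v k X) A M" "k \<le> card X"
  shows "reliable v (topset v k X) ((real (card X))\<^sup>2 * exp (- real R / 18)) (all_pairs R k A M)"
proof -
  let ?T = "topset v k X"
  have M: "M \<subseteq> X" "A \<subseteq> ?T" using assms(1) by (auto simp: straddles_def)
  have "A \<union> topset v (k - card A) M = ?T"
    using straddles_topset(1)[OF assms] M(2) by auto
  moreover have "{y \<in> M. (y, x) \<in> {p \<in> M \<times> M. beats v (fst p) (snd p)}} = {y \<in> M. beats v y x}"
    if "x \<in> M" for x using that by auto
  then have "{x \<in> M. card {y \<in> M. (y, x) \<in> {p \<in> M \<times> M. beats v (fst p) (snd p)}} < k - card A} =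
      topset v (k - card A) M"
    by (auto simp: topset_def rank_def)
  ultimately have "reliable v ?T (real (card (M \<times> M)) * exp (- real R / 18) + 0) (all_pairs R k A M)"
    unfolding all_pairs_def using finite_sub[OF M(1)] reliable_Output[of v ?T]
    by (intro reliable_ask_all) auto
  moreover have "real (card (M \<times> M)) \<le> (real (card X))\<^sup>2"
    using card_mono[OF finite_X M(1)] by (simp add: card_cartesian_product power2_eq_square mult_mono)
  ultimately show ?thesis
    by (elim reliable_mono) (simp add: mult_right_mono)
qed

lemma affordable_refine_direct:
  assumes "M \<subseteq> X" "0 \<le> q" "\<And>A' M'. M' \<subseteq> M \<Longrightarrow> affordable X r q (F A' M')"
  shows "affordable X (Suc r) (real s * real (card M) * real R + q) (refine_direct R s d k F A M)"
proof (cases "M = {}")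
  case True
  then show ?thesis using assms(2) by (simp add: refine_direct_def affordable_Output)
next
  case False
  show ?thesis
    unfolding refine_direct_def Let_def if_not_P[OF False]
  proof (rule affordable_Random)
    fix xs assume xs: "xs \<in> set_pmf (replicate_pmf s (pmf_of_set M))"
    have sub: "set xs \<subseteq> M" and len: "length xs = s"
      using xs False finite_sub[OF assms(1)] by (auto simp: set_replicate_pmf)
    have "card (set xs) \<le> s" using card_length[of xs] len by simp
    then have "real (card (set xs \<times> M)) * real R \<le> real s * real (card M) * real R"
      by (simp add: card_cartesian_product mult_right_mono)
    then show "affordable X (Suc r) (real s * real (card M) * real R + q) (ask R (set xs \<times> M) (\<lambda>G.
       F (A \<union> {x \<in> M. length (filter (\<lambda>y. (y, x) \<in> G) xs) < low_cut s d (k - card A) (card M)})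
        {x \<in> M. low_cut s d (k - card A) (card M) \<le> length (filter (\<lambda>y. (y, x) \<in> G) xs) \<and>
          length (filter (\<lambda>y. (y, x) \<in> G) xs) < high_cut s d (k - card A) (card M)}))"
      using sub assms by (intro affordable_ask_le[where q = q]) auto
  qed (use assms(2) in simp)
qed

text \<open>A bad sample accounts for the first term, and a union bound over at most
  \<open>(card X)^2\<close> pairs for the second. The factor 2 makes the bound agree with that of
  the two-round step.\<close>

lemma reliable_refine_direct:
  assumes "straddles (topset v k X) A M" "k \<le> card X" "s > 0" "0 \<le> d" "0 \<le> \<epsilon>"
    and F: "\<And>A' M'. straddles (topset v k X) A' M' \<Longrightarrow>
      real (card M') \<le> 4 * d * real (card M) / real s + 2 \<Longrightarrow> reliable v (topset v k X) \<epsilon> (F A' M')"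
  shows "reliable v (topset v k X)
    (6 * exp (- 2 * d\<^sup>2 / real s) + 2 * (real (card X))\<^sup>2 * exp (- real R / 18) + \<epsilon>) (refine_direct R s d k F A M)"
proof (cases "M = {}")
  case True
  then have "A = topset v k X" using assms(1) by (auto simp: straddles_def)
  then show ?thesis
    using True assms(5) by (auto simp: refine_direct_def intro!: reliable_mono[OF reliable_Output])
next
  case False
  let ?T = "topset v k X" and ?\<kappa> = "k - card A"
  have M: "M \<subseteq> X" using assms(1) by (auto simp: straddles_def)
  have fin: "finite M" using finite_sub[OF M] .
  have "reliable v ?T (6 * exp (- 2 * d\<^sup>2 / real s) + ((real (card X))\<^sup>2 * exp (- real R / 18) + \<epsilon>))
      (refine_direct R s d k F A M)"
    unfolding refine_direct_def Let_def if_not_P[OF False]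
  proof (rule reliable_Random[where Q = "good_sample v s d ?\<kappa> M"])
    show "measure_pmf.prob (replicate_pmf s (pmf_of_set M)) {xs. \<not> good_sample v s d ?\<kappa> M xs}
      \<le> 6 * exp (- 2 * d\<^sup>2 / real s)"
      using straddles_topset(2)[OF assms(1,2)] by (intro prob_good_sample M False assms)
    show "0 \<le> (real (card X))\<^sup>2 * exp (- real R / 18) + \<epsilon>" using assms(5) by simp
    fix xs assume "xs \<in> set_pmf (replicate_pmf s (pmf_of_set M))" and good: "good_sample v s d ?\<kappa> M xs"
    then have sub: "set xs \<subseteq> M" using False fin by (auto simp: set_replicate_pmf)
    let ?G = "{p \<in> set xs \<times> M. beats v (fst p) (snd p)}"
    have c: "length (filter (\<lambda>y. (y, x) \<in> ?G) xs) = above v xs x" if "x \<in> M" for x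
      unfolding above_def using that by (auto intro!: arg_cong[where f = length] filter_cong)
    let ?A = "A \<union> {x \<in> M. above v xs x < low_cut s d ?\<kappa> (card M)}"
    let ?M = "{x \<in> M. low_cut s d ?\<kappa> (card M) \<le> above v xs x \<and> above v xs x < high_cut s d ?\<kappa> (card M)}"
    let ?F = "\<lambda>G. F (A \<union> {x \<in> M. length (filter (\<lambda>y. (y, x) \<in> G) xs) < low_cut s d ?\<kappa> (card M)})
        {x \<in> M. low_cut s d ?\<kappa> (card M) \<le> length (filter (\<lambda>y. (y, x) \<in> G) xs) \<and>
          length (filter (\<lambda>y. (y, x) \<in> G) xs) < high_cut s d ?\<kappa> (card M)}"
    have "reliable v ?T \<epsilon> (F ?A ?M)"
      using straddles_split[OF assms(1,2) refl good] good by (intro F) (auto simp: good_sample_def)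
    also have "F ?A ?M = ?F ?G"
      by (intro arg_cong2[where f = F] arg_cong2[where f = "(\<union>)"] refl Collect_cong conj_cong) (simp_all only: c)
    finally have "reliable v ?T (real (card (set xs \<times> M)) * exp (- real R / 18) + \<epsilon>) (ask R (set xs \<times> M) ?F)"
      using fin by (intro reliable_ask_all) auto
    moreover have "real (card (set xs \<times> M)) \<le> (real (card X))\<^sup>2"
    proof -
      have "card (set xs) \<le> card X" "card M \<le> card X"
        using sub M by (auto intro!: card_mono finite_X)
      then show ?thesis by (simp add: card_cartesian_product power2_eq_square mult_mono)
    qed
    ultimately show "reliable v ?T ((real (card X))\<^sup>2 * exp (- real R / 18) + \<epsilon>) (ask R (set xs \<times> M) ?F)"
      by (elim reliable_mono) (simp add: mult_right_mono)
  qed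
  then show ?thesis by (rule reliable_mono) simp
qed

lemma affordable_refine_pivot:
  assumes "M \<subseteq> X" "0 \<le> q" "s > 0" "\<And>A' M'. M' \<subseteq> M \<Longrightarrow> affordable X r q (F A' M')"
  shows "affordable X (Suc (Suc r)) ((real s)\<^sup>2 * real R + (2 * real (card M) * real R + q))
    (refine_pivot R s d k F A M)"
proof (cases "M = {}")
  case True
  then show ?thesis using assms(2) by (simp add: refine_pivot_def affordable_Output)
next
  case False
  show ?thesis
    unfolding refine_pivot_def Let_def if_not_P[OF False]
  proof (rule affordable_Random)
    let ?l = "low_cut s d (k - card A) (card M)" and ?u = "high_cut s d (k - card A) (card M)"
    fix xs assume xs: "xs \<in> set_pmf (replicate_pmf s (pmf_of_set M))"
    have sub: "set xs \<subseteq> M" and len: "length xs = s"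
      using xs False finite_sub[OF assms(1)] by (auto simp: set_replicate_pmf)
    have p: "pivot G xs j \<in> M" for G j
      using pivot_in_set[of xs G j] sub len assms(3) by auto
    have two: "real (card ({a, b} \<times> M)) * real R + q \<le> 2 * real (card M) * real R + q" for a b :: 'a
    proof -
      have "card {a, b} \<le> 2" by (cases "a = b") auto
      then show ?thesis by (simp add: card_cartesian_product mult_right_mono)
    qed
    have inner: "affordable X (Suc r) (2 * real (card M) * real R + q)
       (ask R ({pivot G xs ?l, pivot G xs ?u} \<times> M) (\<lambda>H.
         F (A \<union> {x \<in> M. \<not> pivot_test s H (pivot G xs) ?l x})
           {x \<in> M. pivot_test s H (pivot G xs) ?l x \<and> \<not> pivot_test s H (pivot G xs) ?u x}))" for G
      using two p assms(1) by (intro affordable_ask_le[where q = q] assms(4)) auto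
    have "card (set xs) \<le> s" using card_length[of xs] len by simp
    then have "real (card (set xs \<times> set xs)) * real R \<le> (real s)\<^sup>2 * real R"
      by (simp add: card_cartesian_product power2_eq_square mult_mono mult_right_mono)
    then show "affordable X (Suc (Suc r)) ((real s)\<^sup>2 * real R + (2 * real (card M) * real R + q))
       (ask R (set xs \<times> set xs) (\<lambda>G. ask R ({pivot G xs ?l, pivot G xs ?u} \<times> M) (\<lambda>H.
         F (A \<union> {x \<in> M. \<not> pivot_test s H (pivot G xs) ?l x})
           {x \<in> M. pivot_test s H (pivot G xs) ?l x \<and> \<not> pivot_test s H (pivot G xs) ?u x})))"
      using sub assms(1) by (intro affordable_ask_le[where q = "2 * real (card M) * real R + q"] inner) auto
  qed (use assms(2) in simp)
qed

text \<open>Both rounds decide at most \<open>(card X)^2\<close> pairs; for the two pivots this uses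
  \<open>2 \<le> card X\<close>. If all decisions are right, the outcome is the same as that of
  comparing with the whole sample.\<close>

lemma reliable_refine_pivot:
  assumes "straddles (topset v k X) A M" "k \<le> card X" "s > 0" "0 \<le> d" "0 \<le> \<epsilon>" "2 \<le> card X"
    and F: "\<And>A' M'. straddles (topset v k X) A' M' \<Longrightarrow>
      real (card M') \<le> 4 * d * real (card M) / real s + 2 \<Longrightarrow> reliable v (topset v k X) \<epsilon> (F A' M')"
  shows "reliable v (topset v k X)
    (6 * exp (- 2 * d\<^sup>2 / real s) + 2 * (real (card X))\<^sup>2 * exp (- real R / 18) + \<epsilon>) (refine_pivot R s d k F A M)"
proof (cases "M = {}")
  case True
  then have "A = topset v k X" using assms(1) by (auto simp: straddles_def)
  then show ?thesis
    using True assms(5) by (auto simp: refine_pivot_def intro!: reliable_mono[OF reliable_Output])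
next
  case False
  let ?T = "topset v k X" and ?\<kappa> = "k - card A" and ?n2 = "(real (card X))\<^sup>2 * exp (- real R / 18)"
  let ?l = "low_cut s d ?\<kappa> (card M)" and ?u = "high_cut s d ?\<kappa> (card M)"
  have M: "M \<subseteq> X" using assms(1) by (auto simp: straddles_def)
  have fin: "finite M" using finite_sub[OF M] .
  have cardM: "card M \<le> card X" using M by (intro card_mono finite_X)
  have "reliable v ?T (6 * exp (- 2 * d\<^sup>2 / real s) + (?n2 + (?n2 + \<epsilon>))) (refine_pivot R s d k F A M)"
    unfolding refine_pivot_def Let_def if_not_P[OF False]
  proof (rule reliable_Random[where Q = "good_sample v s d ?\<kappa> M"])
    show "measure_pmf.prob (replicate_pmf s (pmf_of_set M)) {xs. \<not> good_sample v s d ?\<kappa> M xs}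
      \<le> 6 * exp (- 2 * d\<^sup>2 / real s)"
      using straddles_topset(2)[OF assms(1,2)] by (intro prob_good_sample M False assms)
    show "0 \<le> ?n2 + (?n2 + \<epsilon>)" using assms(5) by simp
    fix xs assume "xs \<in> set_pmf (replicate_pmf s (pmf_of_set M))" and good: "good_sample v s d ?\<kappa> M xs"
    then have sub: "set xs \<subseteq> M" and len: "length xs = s" using False fin by (auto simp: set_replicate_pmf)
    have subX: "set xs \<subseteq> X" using sub M by blast
    let ?G = "{q \<in> set xs \<times> set xs. beats v (fst q) (snd q)}"
    let ?p = "pivot ?G xs"
    let ?H = "{q \<in> {?p ?l, ?p ?u} \<times> M. beats v (fst q) (snd q)}"
    have test: "pivot_test s ?H ?p j x \<longleftrightarrow> j \<le> above v xs x" if "x \<in> M" "j \<in> {?l, ?u}" for x j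
    proof (cases "1 \<le> j \<and> j \<le> s")
      case True
      then have "beats v (?p j) x \<longleftrightarrow> j \<le> above v xs x"
        using pivot_spec[OF subX, of j x v] len that M by auto
      then show ?thesis using True that by (auto simp: pivot_test_def)
    next
      case False
      moreover have "above v xs x \<le> s" unfolding above_def using len by (metis length_filter_le)
      ultimately show ?thesis by (auto simp: pivot_test_def)
    qed
    let ?A = "A \<union> {x \<in> M. above v xs x < ?l}"
    let ?M = "{x \<in> M. ?l \<le> above v xs x \<and> above v xs x < ?u}"
    let ?F = "\<lambda>G H. F (A \<union> {x \<in> M. \<not> pivot_test s H (pivot G xs) ?l x})
           {x \<in> M. pivot_test s H (pivot G xs) ?l x \<and> \<not> pivot_test s H (pivot G xs) ?u x}"
    have "reliable v ?T \<epsilon> (F ?A ?M)"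
      using straddles_split[OF assms(1,2) refl good] good by (intro F) (auto simp: good_sample_def)
    also have "?A = A \<union> {x \<in> M. \<not> pivot_test s ?H ?p ?l x}"
      using test by (auto simp: not_le)
    also have "?M = {x \<in> M. pivot_test s ?H ?p ?l x \<and> \<not> pivot_test s ?H ?p ?u x}"
      using test by (auto simp: not_le)
    finally have "reliable v ?T (real (card ({?p ?l, ?p ?u} \<times> M)) * exp (- real R / 18) + \<epsilon>)
        (ask R ({?p ?l, ?p ?u} \<times> M) (?F ?G))"
      using fin by (intro reliable_ask_all) auto
    moreover have "real (card ({?p ?l, ?p ?u} \<times> M)) \<le> (real (card X))\<^sup>2"
    proof -
      have "card {?p ?l, ?p ?u} \<le> 2" by (cases "?p ?l = ?p ?u") auto
      then have "card {?p ?l, ?p ?u} * card M \<le> card X * card X"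
        using assms(6) cardM by (intro mult_le_mono) auto
      then have "real (card {?p ?l, ?p ?u} * card M) \<le> real (card X * card X)" by (rule of_nat_mono)
      then show ?thesis by (simp add: card_cartesian_product power2_eq_square)
    qed
    ultimately have inner: "reliable v ?T (?n2 + \<epsilon>) (ask R ({?p ?l, ?p ?u} \<times> M) (?F ?G))"
      by (elim reliable_mono) (simp add: mult_right_mono)
    have "reliable v ?T (real (card (set xs \<times> set xs)) * exp (- real R / 18) + (?n2 + \<epsilon>))
        (ask R (set xs \<times> set xs) (\<lambda>G. ask R ({pivot G xs ?l, pivot G xs ?u} \<times> M) (?F G)))"
      by (rule reliable_ask_all) (use inner in auto)
    moreover have "real (card (set xs \<times> set xs)) \<le> (real (card X))\<^sup>2"
    proof -
      have "card (set xs) \<le> card X" using subX by (intro card_mono finite_X)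
      then show ?thesis by (simp add: card_cartesian_product power2_eq_square mult_mono)
    qed
    ultimately show "reliable v ?T (?n2 + (?n2 + \<epsilon>))
        (ask R (set xs \<times> set xs) (\<lambda>G. ask R ({pivot G xs ?l, pivot G xs ?u} \<times> M) (?F G)))"
      by (elim reliable_mono) (simp add: mult_right_mono)
  qed
  then show ?thesis by (rule reliable_mono) simp
qed

end

section \<open>Parameters\<close>

text \<open>Since \<open>198 = 18 * 11\<close>, a single majority errs with probability at most
  \<open>1 / n^11\<close>.\<close>

definition reps :: "nat \<Rightarrow> nat" where
  "reps n = nat \<lceil>198 * ln (real n)\<rceil>"

text \<open>The square of the size is about \<open>n powr (9/10)\<close>, so the sample can be
  sorted by all comparisons, each repeated \<open>reps n\<close> times.\<close>

definition coarse_size :: "nat \<Rightarrow> nat" where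
  "coarse_size n = nat \<lceil>real n powr (9/20)\<rceil>"

text \<open>Small enough to compare \<open>n powr (59/100)\<close> candidates with the whole sample:
  the exponents add up to 99/100.\<close>

definition fine_size :: "nat \<Rightarrow> nat" where
  "fine_size n = nat \<lceil>real n powr (2/5)\<rceil>"

text \<open>Chosen so that the Hoeffding term for sample size \<open>s\<close> is exactly
  \<open>1 / n^10\<close>.\<close>

definition dev :: "nat \<Rightarrow> nat \<Rightarrow> real" where
  "dev n s = sqrt (5 * real s * ln (real n))"

text \<open>
  The numbers of candidates before the four refinement steps are at most \<open>n\<close>, \<open>n powr (4/5)\<close>,
  \<open>n powr (59/100)\<close> and \<open>n powr (2/5)\<close>: each step divides the number by about the square root of the
  sample size, and the exponents leave room for logarithmic factors.
\<close>

definition sufficiently_large :: "nat \<Rightarrow> bool" where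
  "sufficiently_large n \<longleftrightarrow> 9 \<le> n \<and>
     4 * dev n (coarse_size n) * real n / real (coarse_size n) + 2 + sqrt (5 * real n * ln (real n))
       \<le> real n powr (4/5) / 2 \<and>
     4 * dev n (coarse_size n) * real n powr (4/5) / real (coarse_size n) + 2 \<le> real n powr (59/100) \<and>
     4 * dev n (fine_size n) * real n powr (59/100) / real (fine_size n) + 2 \<le> real n powr (2/5) \<and>
     (real (coarse_size n))\<^sup>2 * real (reps n) + 2 * real n powr (4/5) * real (reps n) +
       real (fine_size n) * real n powr (59/100) * real (reps n) + (real n powr (2/5))\<^sup>2 * real (reps n) \<le> real n \<and>
     dev n (coarse_size n) + 1 \<le> real (coarse_size n) / 2 \<and>
     sqrt (real n) \<le> dev n (coarse_size n) * real n / real (coarse_size n)"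

text \<open>Up to logarithmic factors, a coarse step lowers the exponent by 9/40 and a fine step by
  1/5: from 1 to 31/40 < 4/5, from 4/5 to 23/40 < 59/100, from 59/100 to 39/100 < 2/5. The query
  terms have exponents 9/10, 4/5, 99/100 and 4/5.\<close>

lemma eventually_sufficiently_large: "eventually sufficiently_large at_top"
  unfolding sufficiently_large_def dev_def coarse_size_def fine_size_def reps_def
  by (intro eventually_conj eventually_ge_at_top; real_asymp)

lemma ln_16_ge_2: "2 \<le> ln (16::real)"
proof -
  have "exp (2::real) = exp 1 * exp 1" by (simp flip: exp_add)
  also have "\<dots> \<le> 3 * 3" using exp_le by (intro mult_mono) auto
  finally have "exp (2::real) \<le> 16" by simp
  then show ?thesis by (subst ln_ge_iff) auto
qed

section \<open>Iterated logarithms and towers\<close>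

primrec tower :: "real \<Rightarrow> nat \<Rightarrow> real" where
  "tower b 0 = 1"
| "tower b (Suc j) = b powr tower b j"

declare tower.simps(2) [simp del]

lemma tower_mono: "1 \<le> b \<Longrightarrow> b \<le> b' \<Longrightarrow> 1 \<le> tower b j \<and> tower b j \<le> tower b' j"
proof (induction j)
  case (Suc j)
  have "1 \<le> b powr tower b j" using Suc by (intro ge_one_powr_ge_zero) auto
  moreover have "b powr tower b j \<le> b' powr tower b j" using Suc by (intro powr_mono2) auto
  moreover have "b' powr tower b j \<le> b' powr tower b' j" using Suc by (intro powr_mono) auto
  ultimately show ?case by (auto simp: tower.simps(2))
qed simp

lemma tower_ge_1: "1 \<le> b \<Longrightarrow> 1 \<le> tower b j"
  using tower_mono by blast

text \<open>Uses \<open>b powr t \<ge> t * ln b\<close> and \<open>ln b \<ge> 2\<close>. Doubling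
  bounds costs and errors of successive stages by geometric series.\<close>

lemma tower_doubles:
  assumes "16 \<le> b"
  shows "2 * tower b j \<le> tower b (Suc j)"
proof -
  have t: "1 \<le> tower b j" using assms by (intro tower_ge_1) simp
  have "2 \<le> ln b" using ln_16_ge_2 assms by (meson ln_mono order_trans zero_less_numeral less_le_trans)
  then have "2 * tower b j \<le> tower b j * ln b" using t by (simp add: mult.commute)
  also have "\<dots> \<le> exp (tower b j * ln b)" using exp_ge_add_one_self[of "tower b j * ln b"] by linarith
  also have "\<dots> = tower b (Suc j)" using assms by (simp add: powr_def tower.simps(2))
  finally show ?thesis .
qed

text \<open>Allows the number of stages to be capped at \<open>n\<close>.\<close>

lemma tower_ge_self: "16 \<le> b \<Longrightarrow> real j \<le> tower b j"
proof (induction j)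
  case (Suc j)
  then show ?case using tower_doubles[of b j] tower_ge_1[of b j] by simp
qed simp

text \<open>If iterate \<open>T = J + 1\<close> is the first nonpositive one, then iterate
  \<open>J\<close> is at most 1, the base of the tower, and each step back exponentiates once. This
  saves one round against the iterated logarithm; \<open>2 \<le> n\<close> gives
  \<open>1 \<le> J\<close>.\<close>

lemma log_star_tower:
  assumes "enat r = log_star b (real n) + 4" "b > 1" "2 \<le> n"
  obtains J where "r = J + 5" "real n \<le> tower b J" "1 \<le> J"
proof -
  let ?a = "\<lambda>i. (log b ^^ i) (real n)"
  let ?S = "{i. ?a i \<le> 0}"
  have "?S \<noteq> {}"
  proof
    assume "?S = {}"
    then have "log_star b (real n) = \<infinity>" by (simp add: log_star_def top_enat_def)
    then show False using assms(1) by simp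
  qed
  then have "Inf (enat ` ?S) \<in> enat ` ?S" by (metis Inf_enat_def LeastI_ex ex_in_conv image_is_empty)
  then obtain T where T: "T \<in> ?S" "log_star b (real n) = enat T"
    by (auto simp: log_star_def)
  have least: "T \<le> i" if "i \<in> ?S" for i
  proof -
    have "log_star b (real n) \<le> enat i" unfolding log_star_def using that by (intro INF_lower)
    then show ?thesis using T by simp
  qed
  have r: "r = T + 4" using assms(1) T(2) by (simp add: numeral_eq_enat)
  have pos: "0 < ?a i" if "i < T" for i using least[of i] that by force
  have "T \<noteq> 0" using T(1) assms(3) by (auto intro: Nat.gr0I)
  moreover have "T \<noteq> 1"
  proof
    assume "T = 1"
    then have "log b (real n) \<le> 0" using T(1) by simp
    then show False using assms(2,3) by simp
  qed
  ultimately obtain J where J: "T = Suc J" "1 \<le> J" by (cases T) auto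
  have "?a (J - j) \<le> tower b j" if "j \<le> J" for j
    using that
  proof (induction j)
    case 0
    have "log b (?a J) \<le> 0" using T(1) J(1) by simp
    then show ?case using pos[of J] J(1) assms(2) by simp
  next
    case (Suc j)
    then have "J - j = Suc (J - Suc j)" by simp
    then have "log b (?a (J - Suc j)) \<le> tower b j"
      using Suc.IH Suc.prems by (metis Suc_leD comp_apply funpow.simps(2))
    then show ?case using pos[of "J - Suc j"] J(1) assms(2) by (simp add: log_le_iff tower.simps(2))
  qed
  from this[of J] show ?thesis using that[of J] r J by simp
qed

text \<open>For \<open>b^2 \<le> 2\<close> the logarithm maps values of at least 2 to values of at
  least 2, so the iterated logarithm would be infinite. The bound keeps
  \<open>ln (k * b / \<delta>)\<close> away from 0.\<close>

lemma log_star_base: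
  assumes "enat r = log_star b (real n) + 4" "b > 1" "2 \<le> n"
  shows "sqrt 2 < b"
proof (rule ccontr)
  assume "\<not> sqrt 2 < b"
  then have b: "b\<^sup>2 \<le> 2" using assms(2) real_le_rsqrt real_sqrt_le_iff
    by (metis abs_of_pos less_trans not_less real_sqrt_abs zero_less_one)
  have "2 \<le> (log b ^^ i) (real n)" for i
  proof (induction i)
    case (Suc i)
    have "b powr 2 \<le> (log b ^^ i) (real n)" using Suc b assms(2) by simp
    then show ?case using Suc assms(2) by (simp add: le_log_iff)
  qed (use assms(3) in simp)
  then have "{i. (log b ^^ i) (real n) \<le> 0} = {}" by (auto simp: not_le intro: less_le_trans[of 0 2])
  then have "log_star b (real n) = \<infinity>" by (simp add: log_star_def top_enat_def)
  then show False using assms(1) by simp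
qed

section \<open>Error terms for the chosen parameters\<close>

lemma exp_minus_mult_ln: "n \<ge> 1 \<Longrightarrow> exp (- (real m * ln (real n))) = 1 / real n ^ m"
  unfolding exp_minus exp_of_nat_mult by (simp add: field_simps)

lemma exp_reps_le:
  assumes "n \<ge> 1"
  shows "exp (- real (reps n) / 18) \<le> 1 / real n ^ 11"
proof -
  have "198 * ln (real n) \<le> real (reps n)" unfolding reps_def by linarith
  then have "exp (- real (reps n) / 18) \<le> exp (- (real 11 * ln (real n)))" by simp
  also have "\<dots> = 1 / real n ^ 11"
    using assms by (rule exp_minus_mult_ln)
  finally show ?thesis .
qed

lemma exp_dev_eq:
  assumes "n \<ge> 1" "s > 0"
  shows "exp (- 2 * (dev n s)\<^sup>2 / real s) = 1 / real n ^ 10"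
proof -
  have "- 2 * (dev n s)\<^sup>2 / real s = - (real 10 * ln (real n))"
    using assms by (simp add: dev_def)
  then show ?thesis using exp_minus_mult_ln[OF assms(1), of 10] by metis
qed

lemma refine_error_le:
  assumes "n \<ge> 1" "s > 0"
  shows "6 * exp (- 2 * (dev n s)\<^sup>2 / real s) + 2 * (real n)\<^sup>2 * exp (- real (reps n) / 18) \<le> 8 / real n ^ 9"
proof -
  have "2 * (real n)\<^sup>2 * exp (- real (reps n) / 18) \<le> 2 * (real n)\<^sup>2 * (1 / real n ^ 11)"
    using exp_reps_le[OF assms(1)] by (intro mult_left_mono) auto
  also have "\<dots> = 2 / real n ^ 9"
    using assms(1) by (simp add: field_simps flip: power_add)
  finally have 1: "2 * (real n)\<^sup>2 * exp (- real (reps n) / 18) \<le> 2 / real n ^ 9" .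
  have "real n ^ 9 \<le> real n ^ 10" using assms(1) by (intro power_increasing) auto
  then have "6 * (1 / real n ^ 10) \<le> 6 / real n ^ 9"
    using assms(1) by (simp add: frac_le)
  then show ?thesis using 1 exp_dev_eq[OF assms] by (simp add: field_simps)
qed

section \<open>The last four rounds\<close>

context tie_breaking
begin

abbreviation "n \<equiv> card X"

text \<open>The size tests guarantee the worst-case query bound even when noise has spoiled an
  earlier step; \<open>Output {}\<close> is a dummy answer for that case.\<close>

definition finish :: "nat \<Rightarrow> 'a set \<Rightarrow> 'a set \<Rightarrow> 'a algorithm" where
  "finish k A M = (if real (card M) \<le> real n powr (4/5)
     then refine_pivot (reps n) (coarse_size n) (dev n (coarse_size n)) k (\<lambda>A M.
       if real (card M) \<le> real n powr (59/100)
       then refine_direct (reps n) (fine_size n) (dev n (fine_size n)) k (\<lambda>A M.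
         if real (card M) \<le> real n powr (2/5) then all_pairs (reps n) k A M else Output {}) A M
       else Output {}) A M
     else Output {})"

lemma sample_size_pos: "1 \<le> m \<Longrightarrow> 0 < coarse_size m" "1 \<le> m \<Longrightarrow> 0 < fine_size m"
  by (auto simp: coarse_size_def fine_size_def)

lemma affordable_finish:
  assumes "M \<subseteq> X" "sufficiently_large n"
  shows "affordable X 4 (real n) (finish k A M)"
proof (cases "real (card M) \<le> real n powr (4/5)")
  case False
  then show ?thesis by (simp add: finish_def affordable_Output)
next
  case True
  have n1: "1 \<le> n" using assms(2) by (simp add: sufficiently_large_def)
  let ?R = "real (reps n)"
  let ?q3 = "(real n powr (2/5))\<^sup>2 * ?R"
  let ?q2 = "real (fine_size n) * real n powr (59/100) * ?R + ?q3"
  let ?F3 = "\<lambda>A M. if real (card M) \<le> real n powr (2/5) then all_pairs (reps n) k A M else Output {}"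
  let ?F2 = "\<lambda>A M. if real (card M) \<le> real n powr (59/100)
       then refine_direct (reps n) (fine_size n) (dev n (fine_size n)) k ?F3 A M else Output {}"
  have 3: "affordable X 1 ?q3 (?F3 A' M')" if "M' \<subseteq> X" for A' M'
  proof (cases "real (card M') \<le> real n powr (2/5)")
    case True
    then have "(real (card M'))\<^sup>2 * ?R \<le> ?q3"
      by (intro mult_right_mono power_mono) auto
    then show ?thesis using True affordable_mono[OF affordable_all_pairs[OF that] order_refl] by simp
  qed (simp add: affordable_Output)
  have 2: "affordable X 2 ?q2 (?F2 A' M')" if "M' \<subseteq> X" for A' M'
  proof (cases "real (card M') \<le> real n powr (59/100)")
    case True
    have "affordable X (Suc 1) (real (fine_size n) * real (card M') * ?R + ?q3)
        (refine_direct (reps n) (fine_size n) (dev n (fine_size n)) k ?F3 A' M')"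
      using that by (intro affordable_refine_direct 3) auto
    moreover have "real (fine_size n) * real (card M') * ?R \<le> real (fine_size n) * real n powr (59/100) * ?R"
      using True by (intro mult_right_mono mult_left_mono) auto
    ultimately show ?thesis using True by (auto elim: affordable_mono)
  qed (simp add: affordable_Output)
  have "affordable X (Suc (Suc 2)) ((real (coarse_size n))\<^sup>2 * ?R + (2 * real (card M) * ?R + ?q2))
      (refine_pivot (reps n) (coarse_size n) (dev n (coarse_size n)) k ?F2 A M)"
    using assms(1) sample_size_pos[OF n1] by (intro affordable_refine_pivot 2) auto
  moreover have "2 * real (card M) * ?R \<le> 2 * real n powr (4/5) * ?R"
    using True by (intro mult_right_mono mult_left_mono) auto
  ultimately show ?thesis
    using True assms(2) by (auto simp: finish_def sufficiently_large_def elim!: affordable_mono)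
qed

lemma reliable_all_pairs_reps:
  assumes "straddles (topset v k X) A M" "k \<le> n" "1 \<le> n"
  shows "reliable v (topset v k X) (1 / real n ^ 9) (all_pairs (reps n) k A M)"
proof -
  have "(real n)\<^sup>2 * exp (- real (reps n) / 18) \<le> (real n)\<^sup>2 * (1 / real n ^ 11)"
    using exp_reps_le[OF assms(3)] by (intro mult_left_mono) auto
  also have "\<dots> = 1 / real n ^ 9"
    using assms(3) by (simp add: field_simps flip: power_add)
  finally show ?thesis by (rule reliable_mono[OF reliable_all_pairs[OF assms(1,2)]])
qed

text \<open>With good samples and correct decisions the size tests succeed. Two refinements at
  \<open>8 / n^9\<close> each and the last round at \<open>1 / n^9\<close> stay below
  \<open>24 / n^9\<close>.\<close>

lemma reliable_finish:
  assumes "straddles (topset v k X) A M" "k \<le> n" "sufficiently_large n"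
    and "real (card M) \<le> real n powr (4/5)"
  shows "reliable v (topset v k X) (24 / real n ^ 9) (finish k A M)"
proof -
  let ?T = "topset v k X"
  have n: "1 \<le> n" "2 \<le> n" using assms(3) by (auto simp: sufficiently_large_def)
  let ?F3 = "\<lambda>A M. if real (card M) \<le> real n powr (2/5) then all_pairs (reps n) k A M else Output {}"
  let ?F2 = "\<lambda>A M. if real (card M) \<le> real n powr (59/100)
       then refine_direct (reps n) (fine_size n) (dev n (fine_size n)) k ?F3 A M else Output {}"
  have dev: "0 \<le> dev n s" for s using n by (simp add: dev_def)
  have 2: "reliable v ?T (9 / real n ^ 9) (?F2 A' M')"
    if st: "straddles ?T A' M'" and c: "real (card M') \<le> real n powr (59/100)" for A' M'
  proof -
    have "reliable v ?T (6 * exp (- 2 * (dev n (fine_size n))\<^sup>2 / real (fine_size n)) +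
        2 * (real n)\<^sup>2 * exp (- real (reps n) / 18) + 1 / real n ^ 9)
        (refine_direct (reps n) (fine_size n) (dev n (fine_size n)) k ?F3 A' M')"
    proof (rule reliable_refine_direct[OF st assms(2) _ dev])
      fix A'' M'' assume st': "straddles ?T A'' M''"
        and "real (card M'') \<le> 4 * dev n (fine_size n) * real (card M') / real (fine_size n) + 2"
      moreover have "4 * dev n (fine_size n) * real (card M') / real (fine_size n) \<le>
          4 * dev n (fine_size n) * real n powr (59/100) / real (fine_size n)"
        using c dev by (intro divide_right_mono mult_left_mono) auto
      ultimately have "real (card M'') \<le> real n powr (2/5)"
        using assms(3) by (auto simp: sufficiently_large_def)
      then show "reliable v ?T (1 / real n ^ 9) (?F3 A'' M'')"
        using reliable_all_pairs_reps[OF st' assms(2) n(1)] by simp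
    qed (use sample_size_pos[OF n(1)] in auto)
    then show ?thesis
      using c refine_error_le[OF n(1) sample_size_pos(2)[OF n(1)]] by (auto elim!: reliable_mono)
  qed
  have "reliable v ?T (6 * exp (- 2 * (dev n (coarse_size n))\<^sup>2 / real (coarse_size n)) +
      2 * (real n)\<^sup>2 * exp (- real (reps n) / 18) + 9 / real n ^ 9)
      (refine_pivot (reps n) (coarse_size n) (dev n (coarse_size n)) k ?F2 A M)"
  proof (rule reliable_refine_pivot[OF assms(1,2) _ dev])
    fix A' M' assume st: "straddles ?T A' M'"
      and "real (card M') \<le> 4 * dev n (coarse_size n) * real (card M) / real (coarse_size n) + 2"
    moreover have "4 * dev n (coarse_size n) * real (card M) / real (coarse_size n) \<le>
        4 * dev n (coarse_size n) * real n powr (4/5) / real (coarse_size n)"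
      using assms(4) dev by (intro divide_right_mono mult_left_mono) auto
    ultimately have "real (card M') \<le> real n powr (59/100)"
      using assms(3) by (auto simp: sufficiently_large_def)
    then show "reliable v ?T (9 / real n ^ 9) (?F2 A' M')" by (rule 2[OF st])
  qed (use sample_size_pos[OF n(1)] n in auto)
  moreover have "6 * exp (- 2 * (dev n (coarse_size n))\<^sup>2 / real (coarse_size n)) +
      2 * (real n)\<^sup>2 * exp (- real (reps n) / 18) + 9 / real n ^ 9 \<le> 24 / real n ^ 9"
  proof -
    have "8 / real n ^ 9 + 9 / real n ^ 9 \<le> 24 / real n ^ 9"
      unfolding add_divide_distrib[symmetric] by (rule divide_right_mono) auto
    then show ?thesis using refine_error_le[OF n(1) sample_size_pos(1)[OF n(1)]] by linarith
  qed
  ultimately show ?thesis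
    using assms(4) unfolding finish_def by (auto elim!: reliable_mono)
qed

end

section \<open>Elimination with a single pivot\<close>

text \<open>Since \<open>54 = 3 * 18\<close>, the error of one comparison is at most
  \<open>exp (- 3 * L * t)\<close>.\<close>

definition stage_reps :: "real \<Rightarrow> real \<Rightarrow> nat" where
  "stage_reps L t = nat \<lceil>54 * L * t\<rceil>"

lemma stage_reps_bounds:
  assumes "1 \<le> L" "1 \<le> t"
  shows "exp (- real (stage_reps L t) / 18) \<le> exp (- 3 * L * t)" "real (stage_reps L t) \<le> 108 * L * t"
proof -
  have "1 * 1 \<le> L * t" using assms by (intro mult_mono) auto
  then show "real (stage_reps L t) \<le> 108 * L * t" unfolding stage_reps_def by linarith
  have "54 * L * t \<le> real (stage_reps L t)" unfolding stage_reps_def by linarith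
  then show "exp (- real (stage_reps L t) / 18) \<le> exp (- 3 * L * t)" by simp
qed

context tie_breaking
begin

text \<open>
  Every stage compares the surviving candidates with one fixed pivot \<open>p\<close> that ranks
  below the top \<open>k\<close> and has at most about \<open>n powr (4/5)\<close> elements above it. If at most
  \<open>n / t\<^sup>2\<close> candidates survive, then \<open>54 * L * t\<close> repetitions are affordable, and only a fraction
  \<open>B powr (- 3 * t)\<close> of the candidates below the pivot survives the stage by mistake, so the next
  stage can use \<open>B powr t\<close> in place of \<open>t\<close>.
\<close>

primrec eliminate :: "real \<Rightarrow> real \<Rightarrow> nat \<Rightarrow> 'a \<Rightarrow> nat \<Rightarrow> nat \<Rightarrow> 'a set \<Rightarrow> 'a algorithm" where
  "eliminate B L k p 0 j M = finish k {} M"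
| "eliminate B L k p (Suc m) j M =
     (if real (card M) \<le> real n powr (4/5) \<or> real (card M) > real n / (tower B j)\<^sup>2 then finish k {} M
      else ask (stage_reps L (tower B j)) ({p} \<times> M)
        (\<lambda>G. eliminate B L k p m (Suc j) {x \<in> M. (p, x) \<notin> G}))"

text \<open>With \<open>t = tower B j\<close>, a stage costs at most \<open>n / t^2\<close>
  candidates times \<open>108 * L * t\<close> repetitions, that is \<open>108 * n * L / t\<close>.
  As \<open>t\<close> at least doubles, the later stages together cost no more than that again; the
  extra \<open>n\<close> pays for \<open>finish\<close>.\<close>

lemma affordable_eliminate:
  assumes "M \<subseteq> X" "sufficiently_large n" "p \<in> X" "16 \<le> B" "1 \<le> L"
  shows "affordable X (m + 4) (216 * real n * L / tower B j + real n) (eliminate B L k p m j M)"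
  using assms(1)
proof (induction m arbitrary: j M)
  case (0 j M)
  have "0 \<le> 216 * real n * L / tower B j" using tower_ge_1[of B j] assms by simp
  then show ?case using affordable_mono[OF affordable_finish[OF 0 assms(2), of k "{}"], of 4] by simp
next
  case (Suc m j M)
  let ?t = "tower B j"
  have t: "1 \<le> ?t" using tower_ge_1 assms by simp
  have pos: "0 \<le> 216 * real n * L / ?t" using t assms by simp
  show ?case
  proof (cases "real (card M) \<le> real n powr (4/5) \<or> real (card M) > real n / ?t\<^sup>2")
    case True
    then show ?thesis
      using affordable_mono[OF affordable_finish[OF Suc.prems assms(2), of k "{}"], of "Suc m + 4"] pos by simp
  next
    case False
    have "affordable X (Suc (m + 4)) (216 * real n * L / ?t + real n) (ask (stage_reps L ?t) ({p} \<times> M)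
        (\<lambda>G. eliminate B L k p m (Suc j) {x \<in> M. (p, x) \<notin> G}))"
    proof (rule affordable_ask_le)
      show "affordable X (m + 4) (216 * real n * L / tower B (Suc j) + real n)
          (eliminate B L k p m (Suc j) {x \<in> M. (p, x) \<notin> G})" for G
        using Suc.prems by (intro Suc.IH) auto
      have "real (card ({p} \<times> M)) * real (stage_reps L ?t) \<le> (real n / ?t\<^sup>2) * (108 * L * ?t)"
        using False stage_reps_bounds(2)[OF assms(5) t]
        by (intro mult_mono) (auto simp: card_cartesian_product)
      also have "\<dots> = 108 * real n * L / ?t" using t by (simp add: power2_eq_square)
      finally have 1: "real (card ({p} \<times> M)) * real (stage_reps L ?t) \<le> 108 * real n * L / ?t" .
      have "216 * real n * L / tower B (Suc j) \<le> 216 * real n * L / (2 * ?t)"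
        using tower_doubles[OF assms(4), of j] t assms(5) by (intro divide_left_mono) auto
      also have "\<dots> = 108 * real n * L / ?t" by simp
      finally have "216 * real n * L / tower B (Suc j) \<le> 108 * real n * L / ?t" .
      then have "real (card ({p} \<times> M)) * real (stage_reps L ?t) + (216 * real n * L / tower B (Suc j) + real n)
          \<le> 108 * real n * L / ?t + (108 * real n * L / ?t + real n)"
        using 1 by (intro add_mono order_refl)
      then show "real (card ({p} \<times> M)) * real (stage_reps L ?t) + (216 * real n * L / tower B (Suc j) + real n)
          \<le> 216 * real n * L / ?t + real n"
        by (simp add: mult.commute)
    qed (use Suc.prems assms(3) in auto)
    then show ?thesis using False by simp
  qed
qed

text \<open>Of the budget \<open>\<delta> / (2 * t)\<close> a stage spends half on protecting the
  target, and doubling leaves enough for the later stages. Too many false survivors cost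
  \<open>1 / n^10\<close> per stage.\<close>

lemma reliable_eliminate:
  fixes v k
  defines "T \<equiv> topset v k X"
  assumes "k \<le> n" "1 \<le> k" "sufficiently_large n" "p \<in> X" "16 \<le> B" "0 < \<delta>" "\<delta> \<le> 1" "L = ln (real k * B / \<delta>)"
    and pT: "\<And>x. x \<in> T \<Longrightarrow> \<not> beats v p x"
    and pW: "real (card {x \<in> X. \<not> beats v p x}) + sqrt (5 * real n * ln (real n)) \<le> real n powr (4/5) / 2"
    and "T \<subseteq> M" "M \<subseteq> X"
    and "real (card M) \<le> max (real n powr (4/5)) (real n / (tower B j)\<^sup>2)" "real n \<le> tower B (j + m)"
  shows "reliable v T (\<delta> / (2 * tower B j) + real m / real n ^ 10 + 24 / real n ^ 9) (eliminate B L k p m j M)"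
  using assms(12-15)
proof (induction m arbitrary: j M)
  case (0 j M)
  have n: "1 \<le> real n" using assms(4) by (simp add: sufficiently_large_def)
  have t: "1 \<le> tower B j" using tower_ge_1 assms by simp
  \<comment> \<open>The tower has reached \<open>n\<close>, so the second term of the size bound is
    at most 1.\<close>
  have "real n * 1 \<le> tower B j * tower B j" using 0 n t by (intro mult_mono) auto
  then have "real n / (tower B j)\<^sup>2 \<le> 1" using t by (simp add: power2_eq_square)
  moreover have "1 \<le> real n powr (4/5)" using n by (intro ge_one_powr_ge_zero) auto
  ultimately have "real (card M) \<le> real n powr (4/5)" using 0(3) by simp
  then have "reliable v T (24 / real n ^ 9) (finish k {} M)"
    unfolding T_def using 0(1,2) assms(2,4) by (intro reliable_finish) (auto simp: straddles_def T_def)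
  then show ?case using assms(7) t by (auto elim!: reliable_mono)
next
  case (Suc m j M)
  let ?t = "tower B j" and ?t' = "tower B (Suc j)" and ?e = "sqrt (5 * real n * ln (real n))"
  have n: "1 \<le> n" using assms(4) by (simp add: sufficiently_large_def)
  have t: "1 \<le> ?t" using tower_ge_1 assms by simp
  have t': "2 * ?t \<le> ?t'" using tower_doubles[OF assms(6)] .
  have fin: "finite M" using finite_sub[OF Suc.prems(2)] .
  show ?case
  proof (cases "real (card M) \<le> real n powr (4/5)")
    case True
    then have "reliable v T (24 / real n ^ 9) (finish k {} M)"
      unfolding T_def using Suc.prems(1,2) assms(2,4) by (intro reliable_finish) (auto simp: straddles_def T_def)
    moreover have "0 \<le> \<delta> / (2 * ?t) + real (Suc m) / real n ^ 10" using t assms(7) by simp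
    ultimately show ?thesis using True by (auto elim!: reliable_mono)
  next
    case False
    then have cM: "real (card M) \<le> real n / ?t\<^sup>2" using Suc.prems(3) by simp
    have "0 < real n powr (4/5)" using n by simp
    then have ne: "M \<noteq> {}" using False by auto
    have lnB: "2 \<le> ln B" using ln_16_ge_2 assms(6) by (meson ln_mono order_trans zero_less_numeral less_le_trans)
    have L: "L = ln (real k / \<delta>) + ln B"
      using assms(3,6,7,9) by (simp add: ln_mult ln_div)
    have lk: "0 \<le> ln (real k / \<delta>)" using assms(3,7,8) by (intro ln_ge_zero) simp
    let ?\<beta> = "exp (- real (stage_reps L ?t) / 18)"
    have \<beta>: "?\<beta> \<le> exp (- 3 * L * ?t)"
      using L lk lnB t by (intro stage_reps_bounds) auto
    \<comment> \<open>Here \<open>L \<ge> ln B\<close> turns \<open>exp (- 3 * L * t)\<close> into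
      the inverse cube of \<open>B powr t\<close>, the next tower value. Two of the factors give the
      next size bound, and the third halves it.\<close>
    have "?\<beta> \<le> 1 / ?t' ^ 3"
    proof -
      have "?t * ln B \<le> ?t * L" using L lk t by (intro mult_left_mono) auto
      then have "exp (- 3 * L * ?t) \<le> exp (- (real 3 * (?t * ln B)))" by (simp add: mult.commute)
      also have "\<dots> = 1 / ?t' ^ 3"
        unfolding exp_minus exp_of_nat_mult using assms(6) by (simp add: powr_def tower.simps(2) field_simps)
      finally show ?thesis using \<beta> by linarith
    qed
    then have surv: "real (card M) * ?\<beta> \<le> (real n / ?t'\<^sup>2) / 2"
    proof -
      assume b: "?\<beta> \<le> 1 / ?t' ^ 3"
      have "real n / ?t\<^sup>2 \<le> real n" using t by (simp add: divide_le_eq mult_le_cancel_left1)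
      then have "real (card M) * ?\<beta> \<le> real n * (1 / ?t' ^ 3)"
        using cM b by (intro mult_mono) auto
      also have "\<dots> = (real n / ?t'\<^sup>2) / ?t'" by (simp add: power3_eq_cube power2_eq_square)
      also have "\<dots> \<le> (real n / ?t'\<^sup>2) / 2" using t t' by (intro divide_left_mono) auto
      finally show ?thesis .
    qed
    \<comment> \<open>The summand \<open>ln (k / \<delta>)\<close> of \<open>L\<close> pays for the
      union bound over the \<open>k\<close> target elements, and \<open>ln B \<ge> 2\<close> for the
      factor \<open>1 / (4 * t)\<close>.\<close>
    have crit: "real k * ?\<beta> \<le> \<delta> / (4 * ?t)"
    proof -
      have "ln (real k / \<delta>) * 1 \<le> ln (real k / \<delta>) * (3 * ?t)" using lk t by (intro mult_left_mono) auto
      moreover have "2 * (3 * ?t) \<le> ln B * (3 * ?t)" using lnB t by (intro mult_right_mono) auto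
      ultimately have "ln (real k / \<delta>) + 6 * ?t \<le> 3 * L * ?t" unfolding L by (simp add: algebra_simps)
      then have "exp (- 3 * L * ?t) \<le> exp (- ln (real k / \<delta>) - 6 * ?t)"
        unfolding exp_le_cancel_iff by linarith
      with \<beta> have "?\<beta> \<le> exp (- ln (real k / \<delta>) - 6 * ?t)" by linarith
      also have "\<dots> = (\<delta> / real k) / exp (6 * ?t)"
        using assms(3,7) by (simp add: exp_diff exp_minus)
      also have "\<dots> \<le> (\<delta> / real k) / (4 * ?t)"
      proof (rule divide_left_mono)
        show "4 * ?t \<le> exp (6 * ?t)" using exp_ge_add_one_self[of "6 * ?t"] t by linarith
      qed (use assms(3,7) t in auto)
      finally have "real k * ?\<beta> \<le> real k * ((\<delta> / real k) / (4 * ?t))" by (intro mult_left_mono) auto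
      also have "\<dots> = \<delta> / (4 * ?t)" using assms(3) by simp
      finally show ?thesis .
    qed
    let ?\<epsilon> = "\<delta> / (2 * ?t') + real m / real n ^ 10 + 24 / real n ^ 9"
    have "reliable v T (real (card ({p} \<times> T)) * ?\<beta> + exp (- 2 * ?e\<^sup>2 / real (card ({p} \<times> M))) + ?\<epsilon>)
       (ask (stage_reps L ?t) ({p} \<times> M) (\<lambda>G. eliminate B L k p m (Suc j) {x \<in> M. (p, x) \<notin> G}))"
    proof (rule reliable_ask_critical)
      fix G assume G: "G \<subseteq> {p} \<times> M" "\<forall>q\<in>{p} \<times> T. q \<in> G \<longleftrightarrow> beats v (fst q) (snd q)"
        and bad: "real (card {q \<in> {p} \<times> M. (q \<in> G) \<noteq> beats v (fst q) (snd q)})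
          \<le> real (card ({p} \<times> M)) * ?\<beta> + ?e"
      let ?M' = "{x \<in> M. (p, x) \<notin> G}"
      let ?bad = "{q \<in> {p} \<times> M. (q \<in> G) \<noteq> beats v (fst q) (snd q)}"
      \<comment> \<open>A survivor is either not beaten by the pivot or wrongly judged.\<close>
      have "?M' \<subseteq> {x \<in> X. \<not> beats v p x} \<union> snd ` ?bad"
        using Suc.prems(2) by force
      then have "card ?M' \<le> card ({x \<in> X. \<not> beats v p x} \<union> snd ` ?bad)"
        using finite_X fin by (intro card_mono) auto
      also have "\<dots> \<le> card {x \<in> X. \<not> beats v p x} + card (snd ` ?bad)" by (rule card_Un_le)
      also have "card (snd ` ?bad) \<le> card ?bad" using fin by (intro card_image_le) auto
      finally have "real (card ?M') \<le> real (card {x \<in> X. \<not> beats v p x}) + real (card ?bad)" by linarith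
      also have "\<dots> \<le> real n powr (4/5) / 2 + (real n / ?t'\<^sup>2) / 2"
        using bad pW surv by (simp add: card_cartesian_product)
      also have "\<dots> \<le> max (real n powr (4/5)) (real n / ?t'\<^sup>2)"
        by (simp only: max_def split: if_splits) argo
      finally have card: "real (card ?M') \<le> max (real n powr (4/5)) (real n / ?t'\<^sup>2)" .
      show "reliable v T ?\<epsilon> (eliminate B L k p m (Suc j) ?M')"
      proof (rule Suc.IH)
        show "T \<subseteq> ?M'" using Suc.prems(1) G(2) pT by auto
      qed (use Suc.prems card in auto)
    qed (use fin Suc.prems ne t t' assms(7) n in auto)
    moreover have "card ({p} \<times> T) = k"
      using card_topset[OF order_refl assms(2), of v] by (simp add: card_cartesian_product T_def)
    \<comment> \<open>The deviation is fixed for \<open>n\<close> comparisons; a batch with fewer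
      only improves the exponent.\<close>
    moreover have "exp (- 2 * ?e\<^sup>2 / real (card ({p} \<times> M))) \<le> 1 / real n ^ 10"
    proof -
      have c: "0 < card M" "card M \<le> n" using fin ne Suc.prems(2) by (auto simp: card_gt_0_iff intro: card_mono finite_X)
      have "10 * ln (real n) * real (card M) \<le> 10 * ln (real n) * real n"
        using c n by (intro mult_left_mono) auto
      then have "10 * ln (real n) \<le> 2 * ?e\<^sup>2 / real (card M)"
        using c n by (simp add: field_simps)
      then have "exp (- 2 * ?e\<^sup>2 / real (card ({p} \<times> M))) \<le> exp (- (real 10 * ln (real n)))"
        by (simp add: card_cartesian_product)
      then show ?thesis unfolding exp_minus_mult_ln[OF n] .
    qed
    moreover have "\<delta> / (2 * ?t') \<le> \<delta> / (4 * ?t)"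
      using t t' assms(7) by (intro divide_left_mono) (auto)
    moreover have "\<delta> / (4 * ?t) + \<delta> / (4 * ?t) = \<delta> / (2 * ?t)" by simp
    moreover have "real (Suc m) / real n ^ 10 = real m / real n ^ 10 + 1 / real n ^ 10"
      by (simp add: add_divide_distrib)
    ultimately show ?thesis
      using crit False cM by (auto elim!: reliable_mono)
  qed
qed

section \<open>The algorithms for small and for large k\<close>

text \<open>Intended for a vanishing acceptance threshold, so only the rejecting pivot is computed.
  One round sorts the sample, \<open>J\<close> rounds eliminate, and four finish.\<close>

definition top_small :: "real \<Rightarrow> real \<Rightarrow> nat \<Rightarrow> nat \<Rightarrow> 'a algorithm" where
  "top_small B L k J = Random (map_pmf (\<lambda>xs. ask (reps n) (set xs \<times> set xs) (\<lambda>G.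
     eliminate B L k (pivot G xs (high_cut (coarse_size n) (dev n (coarse_size n)) k n)) J 0 X))
   (replicate_pmf (coarse_size n) (pmf_of_set X)))"

lemma affordable_top_small:
  assumes "sufficiently_large n" "16 \<le> B" "1 \<le> L"
  shows "affordable X (J + 5) (218 * real n * L) (top_small B L k J)"
  unfolding top_small_def
proof (rule affordable_Random)
  have round_eq: "Suc (J + 4) = J + 5" by simp
  have n: "1 \<le> n" using assms(1) by (simp add: sufficiently_large_def)
  have ne: "X \<noteq> {}" using n by auto
  fix xs assume "xs \<in> set_pmf (replicate_pmf (coarse_size n) (pmf_of_set X))"
  then have xs: "set xs \<subseteq> X" "length xs = coarse_size n" "xs \<noteq> []"
    using finite_X ne sample_size_pos(1)[OF n] by (auto simp: set_replicate_pmf)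
  let ?u = "high_cut (coarse_size n) (dev n (coarse_size n)) k n"
  have "affordable X (Suc (J + 4)) (218 * real n * L) (ask (reps n) (set xs \<times> set xs) (\<lambda>G.
     eliminate B L k (pivot G xs ?u) J 0 X))"
  proof (rule affordable_ask_le)
    show "affordable X (J + 4) (216 * real n * L / tower B 0 + real n) (eliminate B L k (pivot G xs ?u) J 0 X)" for G
      using pivot_in_set[OF xs(3)] xs(1) assms by (intro affordable_eliminate) auto
    have "real (card (set xs \<times> set xs)) \<le> (real (coarse_size n))\<^sup>2"
      using card_length[of xs] xs(2) by (simp add: card_cartesian_product power2_eq_square mult_mono)
    then have "real (card (set xs \<times> set xs)) * real (reps n) \<le> (real (coarse_size n))\<^sup>2 * real (reps n)"
      by (intro mult_right_mono) auto
    also have "\<dots> \<le> real n"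
    proof -
      have "0 \<le> 2 * real n powr (4/5) * real (reps n)" "0 \<le> real (fine_size n) * real n powr (59/100) * real (reps n)"
        "0 \<le> (real n powr (2/5))\<^sup>2 * real (reps n)" by simp_all
      then show ?thesis using assms(1) unfolding sufficiently_large_def by linarith
    qed
    finally have "real (card (set xs \<times> set xs)) * real (reps n) \<le> real n" .
    moreover have "real n * 1 \<le> real n * L" using assms(3) by (intro mult_left_mono) auto
    ultimately show "real (card (set xs \<times> set xs)) * real (reps n) + (216 * real n * L / tower B 0 + real n)
        \<le> 218 * real n * L" by simp (simp add: algebra_simps)
  qed (use xs in auto)
  then show "affordable X (J + 5) (218 * real n * L) (ask (reps n) (set xs \<times> set xs) (\<lambda>G.
     eliminate B L k (pivot G xs ?u) J 0 X))" unfolding round_eq .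
qed (use assms in simp)

text \<open>The place where \<open>\<delta> \<ge> 1 / n^7\<close> enters: the errors that do not
  scale with \<open>\<delta>\<close> sum to at most \<open>33 / n^9\<close>, and
  \<open>n^2 \<ge> 81 \<ge> 66\<close> absorbs the constant.\<close>

lemma error_budget:
  assumes "9 \<le> n" "1 / real n ^ 7 \<le> \<delta>"
  shows "33 / real n ^ 9 \<le> \<delta> / 2"
proof -
  have "81 \<le> (real n)\<^sup>2" using assms(1) power_mono[of 9 "real n" 2] by simp
  then have "66 * real n ^ 7 \<le> (real n)\<^sup>2 * real n ^ 7" by (intro mult_right_mono) auto
  then have "66 * real n ^ 7 \<le> real n ^ 9" by (simp flip: power_add)
  then have "66 / real n ^ 9 \<le> 1 / real n ^ 7" using assms(1) by (simp add: field_simps)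
  then show ?thesis using assms(2) by simp
qed

lemma reliable_top_small:
  assumes "sufficiently_large n" "1 \<le> k" "real k \<le> real n / 2" "16 \<le> B" "1 / real n ^ 7 \<le> \<delta>" "\<delta> \<le> 1"
    and L: "L = ln (real k * B / \<delta>)" and J: "real n \<le> tower B J" "J \<le> n"
    and low: "low_cut (coarse_size n) (dev n (coarse_size n)) k n = 0"
  shows "reliable v (topset v k X) \<delta> (top_small B L k J)"
proof -
  let ?s = "coarse_size n" and ?T = "topset v k X"
  let ?d = "dev n ?s"
  let ?u = "high_cut ?s ?d k n"
  have n9: "9 \<le> n" using assms(1) by (simp add: sufficiently_large_def)
  then have n: "1 \<le> n" "0 < n" by auto
  have s: "0 < ?s" using sample_size_pos(1)[OF n(1)] .
  have d: "0 \<le> ?d" using n by (simp add: dev_def)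
  have k: "k \<le> n" using assms(3) by linarith
  have ne: "X \<noteq> {}" using n by auto
  have "0 < 1 / real n ^ 7" using n by simp
  then have \<delta>: "0 < \<delta>" using assms(5) by linarith
  \<comment> \<open>Because \<open>k \<le> n / 2\<close>, the rejection threshold stays within the
    sample, so its pivot exists.\<close>
  have u: "1 \<le> ?u" "?u \<le> ?s"
  proof -
    have "real ?s * real k / real n \<le> real ?s / 2"
      using mult_left_mono[OF assms(3), of "real ?s"] n by (simp add: field_simps)
    moreover have "?d + 1 \<le> real ?s / 2"
      using assms(1) unfolding sufficiently_large_def by blast
    ultimately have "real ?s * real k / real n + ?d < real ?s" by linarith
    then show "?u \<le> ?s" by (simp add: high_cut_le_iff[OF d])
  qed (simp add: high_cut_def)
  let ?\<epsilon> = "\<delta> / (2 * tower B 0) + real J / real n ^ 10 + 24 / real n ^ 9"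
  have "reliable v ?T (6 * exp (- 2 * ?d\<^sup>2 / real ?s) + ((real n)\<^sup>2 * exp (- real (reps n) / 18) + ?\<epsilon>)) (top_small B L k J)"
    unfolding top_small_def
  proof (rule reliable_Random[where Q = "good_sample v ?s ?d k X"])
    show "measure_pmf.prob (replicate_pmf ?s (pmf_of_set X)) {xs. \<not> good_sample v ?s ?d k X xs}
      \<le> 6 * exp (- 2 * ?d\<^sup>2 / real ?s)"
      by (rule prob_good_sample[OF order_refl ne s d k])
    show "0 \<le> (real n)\<^sup>2 * exp (- real (reps n) / 18) + ?\<epsilon>" using \<delta> by simp
    fix xs assume "xs \<in> set_pmf (replicate_pmf ?s (pmf_of_set X))" and good: "good_sample v ?s ?d k X xs"
    then have xs: "set xs \<subseteq> X" "length xs = ?s" "xs \<noteq> []"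
      using finite_X ne s by (auto simp: set_replicate_pmf)
    let ?G = "{q \<in> set xs \<times> set xs. beats v (fst q) (snd q)}"
    let ?p = "pivot ?G xs ?u"
    have piv: "beats v ?p x \<longleftrightarrow> ?u \<le> above v xs x" if "x \<in> X" for x
      using pivot_spec[OF xs(1) u(1) _ that] u(2) xs(2) by simp
    \<comment> \<open>Nothing is accepted, so the elements not beaten by the pivot are exactly the
      undecided ones, of which a good sample leaves few.\<close>
    have W: "{x \<in> X. \<not> beats v ?p x} = {x \<in> X. low_cut ?s ?d k n \<le> above v xs x \<and> above v xs x < ?u}"
      using piv low by auto
    have "reliable v ?T ?\<epsilon> (eliminate B L k ?p J 0 X)"
    proof (rule reliable_eliminate[OF k assms(2,1) _ assms(4) \<delta> assms(6) L])
      show "?p \<in> X" using pivot_in_set[OF xs(3)] xs(1) by blast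
      show "\<not> beats v ?p x" if "x \<in> ?T" for x
        using that good piv[of x] by (auto simp: topset_def good_sample_def)
      show "real (card {x \<in> X. \<not> beats v ?p x}) + sqrt (5 * real n * ln (real n)) \<le> real n powr (4/5) / 2"
        using assms(1) good unfolding W sufficiently_large_def good_sample_def by linarith
    qed (use J in \<open>auto simp: topset_def\<close>)
    then have "reliable v ?T (real (card (set xs \<times> set xs)) * exp (- real (reps n) / 18) + ?\<epsilon>)
        (ask (reps n) (set xs \<times> set xs) (\<lambda>G. eliminate B L k (pivot G xs ?u) J 0 X))"
      by (intro reliable_ask_all) auto
    moreover have "real (card (set xs \<times> set xs)) \<le> (real n)\<^sup>2"
    proof -
      have "card (set xs) \<le> n" using xs(1) by (intro card_mono finite_X)
      then show ?thesis by (simp add: card_cartesian_product power2_eq_square mult_mono)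
    qed
    ultimately show "reliable v ?T ((real n)\<^sup>2 * exp (- real (reps n) / 18) + ?\<epsilon>)
        (ask (reps n) (set xs \<times> set xs) (\<lambda>G. eliminate B L k (pivot G xs ?u) J 0 X))"
      by (elim reliable_mono) (simp add: mult_right_mono)
  qed
  moreover have "6 * exp (- 2 * ?d\<^sup>2 / real ?s) + ((real n)\<^sup>2 * exp (- real (reps n) / 18) + ?\<epsilon>) \<le> \<delta>"
  proof -
    have "real J / real n ^ 10 \<le> real n / real n ^ 10" using J(2) by (intro divide_right_mono) auto
    also have "\<dots> = 1 / real n ^ 9" using n by (simp add: field_simps flip: power_Suc)
    finally have 1: "real J / real n ^ 10 \<le> 1 / real n ^ 9" .
    have 2: "0 \<le> (real n)\<^sup>2 * exp (- real (reps n) / 18)" by simp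
    \<comment> \<open>The summands stem from the stages (where \<open>J \<le> n\<close> is used),
      from \<open>finish\<close>, and from the sampling round.\<close>
    have "1 / real n ^ 9 + 24 / real n ^ 9 + 8 / real n ^ 9 = 33 / real n ^ 9"
      unfolding add_divide_distrib[symmetric] by simp
    then show ?thesis
      using 1 2 refine_error_le[OF n(1) s] error_budget[OF n9 assms(5)]
      unfolding tower.simps(1) mult_1_right by linarith
  qed
  ultimately show ?thesis by (rule reliable_mono)
qed

definition top_large :: "nat \<Rightarrow> 'a algorithm" where
  "top_large k = refine_pivot (reps n) (coarse_size n) (dev n (coarse_size n)) k (finish k) {} X"

lemma reps_le: "9 \<le> m \<Longrightarrow> real (reps m) \<le> 199 * ln (real m)" "9 \<le> m \<Longrightarrow> 2 \<le> ln (real m)"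
proof -
  assume m: "9 \<le> m"
  have "exp (2::real) = exp 1 * exp 1" by (simp flip: exp_add)
  also have "\<dots> \<le> 3 * 3" using exp_le by (intro mult_mono) auto
  also have "\<dots> \<le> real m" using m by simp
  finally show "2 \<le> ln (real m)" using m by (subst ln_ge_iff) auto
  then show "real (reps m) \<le> 199 * ln (real m)" unfolding reps_def by linarith
qed

text \<open>A positive acceptance threshold forces \<open>k > dev * n / s \<ge> sqrt n\<close>,
  hence \<open>ln n \<le> 2 * ln k\<close>. The total is at most
  \<open>2 * n + 398 * n * ln n\<close>, and \<open>2 \<le> ln n\<close> gives at most
  \<open>798 * n * ln k\<close>.\<close>

lemma affordable_top_large:
  assumes "sufficiently_large n" "low_cut (coarse_size n) (dev n (coarse_size n)) k n \<noteq> 0"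
  shows "affordable X 6 (800 * real n * ln (real k)) (top_large k)"
proof -
  let ?s = "coarse_size n" and ?R = "real (reps n)"
  have n9: "9 \<le> n" using assms(1) by (simp add: sufficiently_large_def)
  have s: "0 < ?s" using sample_size_pos(1) n9 by simp
  have "affordable X (Suc (Suc 4)) ((real ?s)\<^sup>2 * ?R + (2 * real n * ?R + real n)) (top_large k)"
    unfolding top_large_def using s assms(1) by (intro affordable_refine_pivot affordable_finish) auto
  moreover have "(real ?s)\<^sup>2 * ?R + (2 * real n * ?R + real n) \<le> 800 * real n * ln (real k)"
  proof -
    have "0 \<le> 2 * real n powr (4/5) * ?R" "0 \<le> real (fine_size n) * real n powr (59/100) * ?R"
      "0 \<le> (real n powr (2/5))\<^sup>2 * ?R" by simp_all
    then have 1: "(real ?s)\<^sup>2 * ?R \<le> real n" using assms(1) unfolding sufficiently_large_def by linarith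
    have "0 < real ?s * real k / real n - dev n ?s"
      using assms(2) low_cut_le_iff[of ?s "dev n ?s" k n 0] by (simp add: not_le)
    then have "dev n ?s * real n / real ?s < real k" using s n9 by (simp add: field_simps)
    then have "sqrt (real n) \<le> real k" using assms(1) unfolding sufficiently_large_def by linarith
    then have "ln (sqrt (real n)) \<le> ln (real k)" using n9 by (intro ln_mono) auto
    then have 2: "ln (real n) \<le> 2 * ln (real k)" using n9 by (simp add: ln_sqrt)
    have "2 * real n * ?R \<le> 2 * real n * (199 * ln (real n))"
      using reps_le(1)[OF n9] by (intro mult_left_mono) auto
    moreover have "real n * 2 \<le> real n * ln (real n)" using reps_le(2)[OF n9] by (intro mult_left_mono) auto
    moreover have "real n * ln (real n) \<le> real n * (2 * ln (real k))" using 2 by (intro mult_left_mono) auto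
    ultimately show ?thesis using 1 by linarith
  qed
  ultimately show ?thesis by (auto elim: affordable_mono)
qed

lemma reliable_top_large:
  assumes "sufficiently_large n" "k \<le> n" "1 / real n ^ 7 \<le> \<delta>"
  shows "reliable v (topset v k X) \<delta> (top_large k)"
proof -
  let ?s = "coarse_size n" and ?T = "topset v k X"
  have n9: "9 \<le> n" using assms(1) by (simp add: sufficiently_large_def)
  then have n: "1 \<le> n" by simp
  have s: "0 < ?s" using sample_size_pos(1)[OF n] .
  have d: "0 \<le> dev n ?s" using n by (simp add: dev_def)
  have "reliable v ?T (6 * exp (- 2 * (dev n ?s)\<^sup>2 / real ?s) + 2 * (real n)\<^sup>2 * exp (- real (reps n) / 18) + 24 / real n ^ 9)
      (top_large k)"
    unfolding top_large_def
  proof (rule reliable_refine_pivot[OF _ assms(2) s d])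
    fix A M assume st: "straddles ?T A M" and c: "real (card M) \<le> 4 * dev n ?s * real n / real ?s + 2"
    have "0 \<le> sqrt (5 * real n * ln (real n))" "0 \<le> real n powr (4/5)" using n by simp_all
    then have "real (card M) \<le> real n powr (4/5)"
      using c assms(1) unfolding sufficiently_large_def by linarith
    then show "reliable v ?T (24 / real n ^ 9) (finish k A M)"
      by (intro reliable_finish st assms)
  qed (use n9 in \<open>auto simp: straddles_def topset_def\<close>)
  moreover have "24 / real n ^ 9 + 8 / real n ^ 9 \<le> 33 / real n ^ 9"
    unfolding add_divide_distrib[symmetric] by (intro divide_right_mono) auto
  moreover have "0 < 1 / real n ^ 7" using n9 by simp
  ultimately show ?thesis
    using refine_error_le[OF n s] error_budget[OF n9 assms(3)] assms(3) by (elim reliable_mono) linarith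
qed

end

section \<open>Assembling the final bound\<close>

lemma reliable_imp_prob_is_top_k:
  assumes "tie_breaking X idx" "k \<le> card X"
    and "reliable v (tie_breaking.topset idx v k X) \<delta> A"
  shows "measure_pmf.prob (run v adv A []) {S. is_top_k v X k S} \<ge> 1 - \<delta>"
proof -
  interpret tie_breaking X idx by fact
  let ?p = "run v adv A []" and ?T = "topset v k X"
  have "measure_pmf.prob ?p (- {?T}) \<le> \<delta>" using assms(3) by (simp add: reliable_def)
  then have "1 - \<delta> \<le> measure_pmf.prob ?p {?T}"
    using measure_pmf.prob_compl[of "{?T}" ?p] by (simp add: Compl_eq_Diff_UNIV)
  also have "\<dots> \<le> measure_pmf.prob ?p {S. is_top_k v X k S}"
    using is_top_k_topset[OF assms(2)] by (intro measure_pmf.finite_measure_mono) auto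
  finally show ?thesis .
qed

text \<open>Enlarging \<open>b\<close> to at least 16 costs only a constant factor:
  \<open>ln b \<ge> ln 2 / 2\<close>, so \<open>ln 16 = 4 * ln 2\<close> is at most
  \<open>8 * ln b\<close>.\<close>

lemma ln_ratio_ge:
  assumes "sqrt 2 < b" "1 \<le> k" "0 < \<delta>" "\<delta> \<le> 1"
  shows "1 / 4 \<le> ln (real k * b / \<delta>)"
    and "ln (real k * max b 16 / \<delta>) \<le> 16 * ln (real k * b / \<delta>)"
    and "1 \<le> ln (real k * max b 16 / \<delta>)"
    and "ln (real k) \<le> ln (real k * b / \<delta>)"
proof -
  have b: "1 < b" using assms(1) by (smt (verit) real_sqrt_gt_1_iff)
  have split: "ln (real k * c / \<delta>) = ln (real k) + ln c + ln (1 / \<delta>)" if "0 < c" for c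
    using that assms by (simp add: ln_mult ln_div)
  have k: "0 \<le> ln (real k)" and d: "0 \<le> ln (1 / \<delta>)" using assms by (auto intro!: ln_ge_zero)
  have "ln (sqrt 2) \<le> ln b" using assms(1) by (intro ln_mono) auto
  then have lb2: "ln 2 / 2 \<le> ln b" by (simp add: ln_sqrt)
  have "ln (16::real) = ln (2 ^ 4)" by simp
  then have ln16: "ln (16::real) = 4 * ln 2" unfolding ln_realpow[of 2] by simp
  then have ln2: "1 / 2 \<le> ln (2::real)" using ln_16_ge_2 by linarith
  show "1 / 4 \<le> ln (real k * b / \<delta>)" "ln (real k) \<le> ln (real k * b / \<delta>)"
    using split[of b] b k d lb2 ln2 by linarith+
  have "ln (max b 16) \<le> 16 * ln b" using lb2 ln16 ln2 by (auto simp: max_def)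
  then show "ln (real k * max b 16 / \<delta>) \<le> 16 * ln (real k * b / \<delta>)"
    using split[of b] split[of "max b 16"] b k d by linarith
  have "ln 16 \<le> ln (max b 16)" by (intro ln_mono) auto
  then show "1 \<le> ln (real k * max b 16 / \<delta>)"
    using split[of "max b 16"] k d ln_16_ge_2 by linarith
qed

theorem mainTheorem8:
  "\<exists>C>0. \<forall>(X :: 'a set) (n :: nat) (k :: nat) (r :: nat) (\<delta> :: real) (b :: real).
     finite X \<and> card X = n \<and> 1 \<le> k \<and> real k \<le> real n / 2 \<and>
     1 / real n ^ 7 \<le> \<delta> \<and> \<delta> \<le> 1 \<and>
     b > 1 \<and> enat r = log_star b (real n) + 4
     \<longrightarrow>
     (\<exists>(Top :: 'a algorithm) (q :: nat).
        queried Top \<subseteq> X \<times> X \<and>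
        rounds Top \<le> enat r \<and>
        query_count Top \<le> enat q \<and>
        real q \<le> C * real n * ln (real k * b / \<delta>) \<and>
        (\<forall>(v :: 'a \<Rightarrow> real) (adv :: 'a adversary).
           measure_pmf.prob (run v adv Top []) {S. is_top_k v X k S} \<ge> 1 - \<delta>))"
proof -
  obtain N0 where N0: "\<And>n. N0 \<le> n \<Longrightarrow> sufficiently_large n"
    using eventually_sufficiently_large by (auto simp: eventually_at_top_linorder)
  \<comment> \<open>\<open>3488 = 218 * 16\<close> covers the case of small \<open>k\<close>. The
    second summand pays for comparing all pairs when \<open>n < N0\<close>, where the logarithm is
    at least 1/4.\<close>
  define C where "C = 3488 + 4 * real N0 * real (reps N0)"
  have C: "3488 \<le> C" "4 * real N0 * real (reps N0) \<le> C" by (simp_all add: C_def)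
  have main: "\<exists>(Top :: 'a algorithm) (q :: nat).
        queried Top \<subseteq> X \<times> X \<and> rounds Top \<le> enat r \<and> query_count Top \<le> enat q \<and>
        real q \<le> C * real n * ln (real k * b / \<delta>) \<and>
        (\<forall>(v :: 'a \<Rightarrow> real) (adv :: 'a adversary).
           measure_pmf.prob (run v adv Top []) {S. is_top_k v X k S} \<ge> 1 - \<delta>)"
    if hyps: "finite X" "card X = n" "1 \<le> k" "real k \<le> real n / 2" "1 / real n ^ 7 \<le> \<delta>" "\<delta> \<le> 1" "b > 1"
      "enat r = log_star b (real n) + 4" for X :: "'a set" and n k r \<delta> b
  proof -
    have n: "2 \<le> n" "k \<le> n" using hyps(3,4) by linarith+
    have "0 < 1 / real n ^ 7" using n by simp
    then have \<delta>: "0 < \<delta>" using hyps(5) by linarith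
    obtain J where J: "r = J + 5" "real n \<le> tower b J" "1 \<le> J"
      using log_star_tower[OF hyps(8,7) n(1)] .
    note ratio = ln_ratio_ge[OF log_star_base[OF hyps(8,7) n(1)] hyps(3) \<delta> hyps(6)]
    obtain idx :: "'a \<Rightarrow> nat" where "inj_on idx X"
      using finite_imp_inj_to_nat_seg[OF hyps(1)] by blast
    with hyps(1) have tb: "tie_breaking X idx" by unfold_locales
    interpret tie_breaking X idx by fact
    let ?\<Lambda> = "ln (real k * b / \<delta>)"
    have "\<exists>A q. affordable X r q A \<and> q \<le> C * real n * ?\<Lambda> \<and> (\<forall>v. reliable v (topset v k X) \<delta> A)"
    proof (cases "N0 \<le> n")
      case False
      let ?A = "all_pairs (reps n) k {} X"
      have "affordable X r ((real n)\<^sup>2 * real (reps n)) ?A"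
        using affordable_mono[OF affordable_all_pairs[OF order_refl, of "reps n" k "{}"], of r] J(1) hyps(2) by simp
      moreover have "(real n)\<^sup>2 * real (reps n) \<le> C * real n * ?\<Lambda>"
      proof -
        have "reps n \<le> reps N0" unfolding reps_def using False n by (intro nat_mono ceiling_mono) simp
        then have "real n * real (reps n) \<le> real N0 * real (reps N0)" using False by (intro mult_mono) auto
        also have "\<dots> \<le> C * (1 / 4)" using C(2) by simp
        also have "\<dots> \<le> C * ?\<Lambda>" using C(1) ratio(1) by (intro mult_left_mono) auto
        finally have "real n * (real n * real (reps n)) \<le> real n * (C * ?\<Lambda>)" by (intro mult_left_mono) auto
        then show ?thesis by (simp add: power2_eq_square mult.assoc mult.left_commute)
      qed
      moreover have "reliable v (topset v k X) \<delta> ?A" for v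
      proof -
        have "1 / real n ^ 9 \<le> 1 / real n ^ 7" using n by (intro divide_left_mono power_increasing) auto
        then show ?thesis
          using reliable_all_pairs_reps[of v k "{}" X] n hyps(2,5)
          by (auto simp: straddles_def topset_def elim!: reliable_mono)
      qed
      ultimately show ?thesis by blast
    next
      case True
      then have large: "sufficiently_large (card X)" using N0 hyps(2) by simp
      show ?thesis
      proof (cases "low_cut (coarse_size n) (dev n (coarse_size n)) k n = 0")
        case True
        \<comment> \<open>Base at least 16 provides the doubling of towers; at most \<open>n\<close>
          stages keep their error terms within the budget.\<close>
        let ?B = "max b 16" and ?J = "min J n"
        let ?L = "ln (real k * ?B / \<delta>)"
        have "real n \<le> tower ?B ?J"
        proof (cases "J \<le> n")
          case True
          then show ?thesis using J(2) tower_mono[of b ?B J] hyps(7) by simp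
        qed (use tower_ge_self[of ?B n] in simp)
        then have "reliable v (topset v k X) \<delta> (top_small ?B ?L k ?J)" for v
          using True hyps large by (intro reliable_top_small) auto
        moreover have "affordable X r (218 * real n * ?L) (top_small ?B ?L k ?J)"
          using affordable_mono[OF affordable_top_small[of ?B ?L ?J k], of r] large ratio(3) hyps(2) J(1) by simp
        moreover have "218 * real n * ?L \<le> C * real n * ?\<Lambda>"
        proof -
          have "218 * real n * ?L \<le> 218 * real n * (16 * ?\<Lambda>)" using ratio(2) by (intro mult_left_mono) auto
          also have "\<dots> = 3488 * (real n * ?\<Lambda>)" by simp
          also have "\<dots> \<le> C * (real n * ?\<Lambda>)" using C(1) ratio(1) by (intro mult_right_mono) auto
          finally show ?thesis by (simp add: mult.assoc)
        qed
        ultimately show ?thesis by blast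
      next
        case False
        then have "affordable X 6 (800 * real n * ln (real k)) (top_large k)"
          using affordable_top_large[OF large] hyps(2) by simp
        \<comment> \<open>Six rounds are available, since \<open>r = J + 5\<close> and
          \<open>1 \<le> J\<close>.\<close>
        then have "affordable X r (800 * real n * ln (real k)) (top_large k)"
          using J by (auto elim: affordable_mono)
        moreover have "800 * real n * ln (real k) \<le> C * real n * ?\<Lambda>"
          using C(1) ratio(1,4) hyps(3) by (intro mult_mono) auto
        moreover have "reliable v (topset v k X) \<delta> (top_large k)" for v
          using reliable_top_large[OF large] n hyps(2,5) by simp
        ultimately show ?thesis by blast
      qed
    qed
    then obtain A q where A: "affordable X r q A" "q \<le> C * real n * ?\<Lambda>" "\<And>v. reliable v (topset v k X) \<delta> A"
      by blast
    have "0 \<le> q" using A(1) by (simp add: affordable_def)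
    then have "real (nat \<lfloor>q\<rfloor>) \<le> C * real n * ?\<Lambda>" using A(2) by linarith
    moreover have "measure_pmf.prob (run v adv A []) {S. is_top_k v X k S} \<ge> 1 - \<delta>" for v adv
      using reliable_imp_prob_is_top_k[OF tb _ A(3)] n hyps(2) by simp
    ultimately show ?thesis using A(1) unfolding affordable_def by blast
  qed
  show ?thesis
  proof (rule exI[of _ C], rule conjI)
    show "0 < C" using C(1) by simp
  qed (intro allI impI, elim conjE, rule main; assumption)
qed

end
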